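(* Let $d\ge1$, $J\ge0$, $\alpha>0$ and $u(x)=\alpha x^2$ for $x\in\mathbb{R}$. For a finite set $\Lambda\subset\mathbb{Z}^d$ and $\omega\in\mathbb{R}^{\mathbb{Z}^d}$ let $$U_\Lambda^\omega(x_\Lambda)=\sum_{i\in\Lambda}u(x_i)+J\sum_{\langle ij\rangle:\,i,j\in\Lambda}(x_i-x_j)^2+J\sum_{i\in\Lambda,\,j\in N(i)\setminus\Lambda}(x_i-\omega_j)^2,\qquad x_\Lambda=(x_i)_{i\in\Lambda}\in\mathbb{R}^\Lambda$$ (i.e. the potential with Hamiltonian $H(x)=J\sum_{\langle ij\rangle}(x_i-x_j)^2$ and boundary condition $\omega$). Then $$\inf_{\Lambda}\ \inf_{\omega\in\mathbb{R}^{\mathbb{Z}^d}}\lambda_1\big(U_\Lambda^\omega\big)\ \ge\ \inf_{\Lambda}\ \inf_{\omega\in\mathbb{R}^{\mathbb{Z}^d}}\sigma\big(U_\Lambda^\omega\big)\ \ge\ 2\alpha,$$ where $\Lambda$ runs over all finite (nonempty) subsets of $\mathbb{Z}^d$.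
   Context: $\langle ij\rangle$ denotes a nearest-neighbour bond of $\mathbb{Z}^d$ (unordered pair, each counted once), and $N(i)$ is the set of the $2d$ nearest neighbours of $i\in\mathbb{Z}^d$. For $U\in C^\infty(\mathbb{R}^\Lambda)$ with $Z=\int e^{-U}dx<\infty$, let $d\mu_U=e^{-U}dx/Z$ and $D(f)=\int|\nabla f|^2d\mu_U$. The spectral gap $\lambda_1(U)$ is the largest constant $\kappa$ such that $\kappa\,\mathrm{Var}_{\mu_U}(f)\le D(f)$ for all $f\in C_0^\infty(\mathbb{R}^\Lambda)$. The logarithmic Sobolev constant $\sigma(U)$ is the largest constant $\sigma$ such that $\sigma\,\mathrm{Ent}_{\mu_U}(f^2)\le2D(f)$ for all $f$ in the domain of the Dirichlet form $D$ (equivalently, for all $f\in C_0^\infty(\mathbb{R}^\Lambda)$), where $\mathrm{Ent}_\mu(g)=\mu(g\log g)-\mu(g)\log\mu(g)$ for $g\ge0$ and $\mu(g)=\int g\,d\mu$. *)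

theory Defs
  imports "HOL-Probability.Probability"
begin

text \<open>For a finite index set \<open>\<Lambda>\<close>, the space \<open>\<real>\<^sup>\<Lambda>\<close> is modelled by the extensional functions
  on \<open>\<Lambda>\<close>, which form the underlying space of the library's product measures. Its topology is the
  one inherited from the product topology on functions. Functions on \<open>\<real>\<^sup>\<Lambda>\<close> are only ever
  evaluated at such extensional points.\<close>

abbreviation config_space :: "'i set \<Rightarrow> ('i \<Rightarrow> real) set" where
  "config_space \<Lambda> \<equiv> \<Lambda> \<rightarrow>\<^sub>E UNIV"

abbreviation config_lborel :: "'i set \<Rightarrow> ('i \<Rightarrow> real) measure" where
  "config_lborel \<Lambda> \<equiv> PiM \<Lambda> (\<lambda>_. lborel)"

definition partial_deriv :: "'i \<Rightarrow> (('i \<Rightarrow> real) \<Rightarrow> real) \<Rightarrow> ('i \<Rightarrow> real) \<Rightarrow> real" where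
  "partial_deriv i f x = deriv (\<lambda>t. f (x(i := t))) (x i)"

text \<open>\<open>C\<^sup>\<infinity>(\<real>\<^sup>\<Lambda>)\<close>: all iterated partial derivatives (of every order, in every sequence of
  directions) exist and are continuous.\<close>

definition smooth_fun :: "'i set \<Rightarrow> (('i \<Rightarrow> real) \<Rightarrow> real) \<Rightarrow> bool" where
  "smooth_fun \<Lambda> f \<longleftrightarrow>
     (\<forall>is \<in> lists \<Lambda>.
        continuous_on (config_space \<Lambda>) (fold partial_deriv is f) \<and>
        (\<forall>i\<in>\<Lambda>. \<forall>x\<in>config_space \<Lambda>.
           (\<lambda>t. fold partial_deriv is f (x(i := t))) differentiable (at (x i))))"

definition test_funs :: "'i set \<Rightarrow> (('i \<Rightarrow> real) \<Rightarrow> real) set" where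
  "test_funs \<Lambda> =
     {f. smooth_fun \<Lambda> f \<and> compact (closure {x \<in> config_space \<Lambda>. f x \<noteq> 0})}"

definition partition_fun :: "'i set \<Rightarrow> (('i \<Rightarrow> real) \<Rightarrow> real) \<Rightarrow> ennreal" where
  "partition_fun \<Lambda> U = (\<integral>\<^sup>+ x. ennreal (exp (- U x)) \<partial>config_lborel \<Lambda>)"

definition gibbs :: "'i set \<Rightarrow> (('i \<Rightarrow> real) \<Rightarrow> real) \<Rightarrow> ('i \<Rightarrow> real) measure" where
  "gibbs \<Lambda> U =
     density (config_lborel \<Lambda>) (\<lambda>x. ennreal (exp (- U x)) / partition_fun \<Lambda> U)"

definition dirichlet ::
    "'i set \<Rightarrow> (('i \<Rightarrow> real) \<Rightarrow> real) \<Rightarrow> (('i \<Rightarrow> real) \<Rightarrow> real) \<Rightarrow> real" where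
  "dirichlet \<Lambda> U f = (\<integral>x. (\<Sum>i\<in>\<Lambda>. (partial_deriv i f x)\<^sup>2) \<partial>gibbs \<Lambda> U)"

text \<open>Since \<^term>\<open>ln (0::real) = 0\<close>, the convention \<open>0 log 0 = 0\<close> is built in.\<close>

definition Ent :: "'a measure \<Rightarrow> ('a \<Rightarrow> real) \<Rightarrow> real" where
  "Ent M g = (\<integral>x. g x * ln (g x) \<partial>M) - (\<integral>x. g x \<partial>M) * ln (\<integral>x. g x \<partial>M)"

text \<open>The admissible constants form a closed set of reals containing \<open>0\<close>, so the largest one is
  the supremum; it is taken in the extended reals, so that no boundedness side condition is hidden
  in the definitions.\<close>

definition spectral_gap :: "'i set \<Rightarrow> (('i \<Rightarrow> real) \<Rightarrow> real) \<Rightarrow> ereal" where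
  "spectral_gap \<Lambda> U =
     Sup {ereal \<kappa> | \<kappa>. \<forall>f \<in> test_funs \<Lambda>.
            \<kappa> * prob_space.variance (gibbs \<Lambda> U) f \<le> dirichlet \<Lambda> U f}"

definition log_sobolev_const :: "'i set \<Rightarrow> (('i \<Rightarrow> real) \<Rightarrow> real) \<Rightarrow> ereal" where
  "log_sobolev_const \<Lambda> U =
     Sup {ereal \<sigma> | \<sigma>. \<forall>f \<in> test_funs \<Lambda>.
            \<sigma> * Ent (gibbs \<Lambda> U) (\<lambda>x. (f x)\<^sup>2) \<le> 2 * dirichlet \<Lambda> U f}"

text \<open>The lattice \<open>\<int>\<^sup>d\<close> is \<^typ>\<open>int ^ 'd\<close> with \<open>d = CARD('d) \<ge> 1\<close>.\<close>

definition neighbours :: "int ^ 'd \<Rightarrow> (int ^ 'd) set" where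
  "neighbours i = range (\<lambda>k. i + axis k 1) \<union> range (\<lambda>k. i - axis k 1)"

text \<open>The second sum runs over ordered pairs and so meets each bond inside \<open>\<Lambda>\<close> exactly twice,
  hence the factor \<open>1/2\<close>.\<close>

definition potential ::
    "(real \<Rightarrow> real) \<Rightarrow> real \<Rightarrow> (int ^ 'd) set \<Rightarrow> (int ^ 'd \<Rightarrow> real) \<Rightarrow> (int ^ 'd \<Rightarrow> real) \<Rightarrow> real" where
  "potential u J \<Lambda> \<omega> x =
     (\<Sum>i\<in>\<Lambda>. u (x i))
     + J * ((1/2) * (\<Sum>i\<in>\<Lambda>. \<Sum>j \<in> neighbours i \<inter> \<Lambda>. (x i - x j)\<^sup>2))
     + J * (\<Sum>i\<in>\<Lambda>. \<Sum>j \<in> neighbours i - \<Lambda>. (x i - \<omega> j)\<^sup>2)"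

end

theory Submission
  imports Defs "HOL-Real_Asymp.Real_Asymp"
begin

text \<open>The potential is the sum of \<open>\<alpha> \<bar>x\<bar>\<^sup>2\<close> and a convex function of the configuration, whatever the volume
  and the boundary condition. Hence \<open>t U x + s U y - U (t x + s y) \<ge> \<alpha> t s \<bar>x - y\<bar>\<^sup>2\<close> for positive
  \<open>t\<close>, \<open>s\<close> with \<open>t + s = 1\<close> (lemma \<open>potential_uniformly_convex\<close>), and such uniform convexity alone forces a
  logarithmic Sobolev inequality with constant \<open>2 \<alpha>\<close> (theorem \<open>log_sobolev_uniformly_convex\<close>).

  The latter is derived from the Prekopa-Leindler inequality, following Bobkov and Ledoux. Take
  \<open>G = f\<^sup>2\<close>, made positive by adding a small constant, and apply the inequality to \<open>G powr p * exp (- U)\<close>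
  and \<open>exp (- U)\<close> with \<open>t = 1 / p\<close>. The convexity defect of \<open>U\<close> allows the third function to be
  \<open>Q * exp (- U)\<close>, where \<open>Q\<close> bounds the sup-convolution of \<open>G\<close> with a Gaussian kernel of width
  \<open>\<tau> = (p - 1) / \<alpha>\<close>; by Cauchy-Schwarz, \<open>Q\<close> is \<open>f\<^sup>2 + \<tau> \<bar>\<nabla>f\<bar>\<^sup>2\<close> up to errors of lower order. The
  result is a bound of the \<open>p\<close>-norm of \<open>G\<close> by \<open>\<integral>G + ((p - 1) / \<alpha>) D(f)\<close>, where \<open>D\<close> is the Dirichlet
  form, with equality at \<open>p = 1\<close>, and
  comparing derivatives at \<open>p = 1\<close> yields \<open>\<alpha> Ent(f\<^sup>2) \<le> D(f)\<close>. The only step that involves the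
  dimension is the Prekopa-Leindler inequality, which is proved by induction over the coordinates
  from the one-dimensional Brunn-Minkowski inequality.

  The comparison of the two constants holds for each Gibbs measure separately (theorem
  \<open>log_sobolev_imp_poincare\<close>): inserting \<open>1 + e (f - \<integral>f)\<close> in the logarithmic Sobolev inequality and
  expanding to second order in \<open>e\<close> gives the Poincare inequality with the same constant. Constants
  are no compactly supported test functions, so they are approximated by smooth cutoffs whose
  gradients tend to \<open>0\<close> uniformly.\<close>

section \<open>The Prekopa-Leindler inequality\<close>

lemma emeasure_real_affine_preimage:
  fixes c d :: real
  assumes [measurable]: "S \<in> sets borel" and c: "c > 0"
  shows "emeasure lborel S = ennreal c * emeasure lborel {x. d + c * x \<in> S}"
proof -
  have [measurable]: "{x. d + c * x \<in> S} \<in> sets borel" by measurable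
  have "emeasure lborel S = (\<integral>\<^sup>+x. indicator S x \<partial>lborel)" by simp
  also have "\<dots> = ennreal c * (\<integral>\<^sup>+x. indicator S (d + c * x) \<partial>lborel)"
    using c by (subst nn_integral_real_affine[where c=c and t=d]) auto
  also have "(\<integral>\<^sup>+x. indicator S (d + c * x) \<partial>lborel) = (\<integral>\<^sup>+x. indicator {x. d + c * x \<in> S} x \<partial>lborel)"
    by (intro nn_integral_cong) (auto simp: indicator_def)
  finally show ?thesis by simp
qed

text \<open>The one-dimensional Brunn-Minkowski inequality rests on the order of the line. The point
  \<open>m = t a + s b\<close> cuts \<open>C\<close> in two: the image of \<open>A \<inter> {..<a}\<close> under \<open>x \<mapsto> t x + s b\<close> lies below \<open>m\<close>, that of
  \<open>B \<inter> {b..}\<close> under \<open>y \<mapsto> t a + s y\<close> at or above \<open>m\<close>. Hence their measures add up.\<close>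

lemma brunn_minkowski_pivot:
  fixes A B C :: "real set"
  assumes [measurable]: "A \<in> sets borel" "B \<in> sets borel" "C \<in> sets borel"
    and ts: "0 < t" "0 < s" and ab: "a \<in> A" "b \<in> B"
    and sub: "\<And>x y. x \<in> A \<Longrightarrow> y \<in> B \<Longrightarrow> t * x + s * y \<in> C"
  shows "ennreal t * emeasure lborel (A \<inter> {..<a}) + ennreal s * emeasure lborel (B \<inter> {b..})
           \<le> emeasure lborel C"
proof -
  define m where "m = t * a + s * b"
  have l: "ennreal t * emeasure lborel (A \<inter> {..<a}) \<le> emeasure lborel (C \<inter> {..<m})"
  proof -
    have "A \<inter> {..<a} \<subseteq> {x. s * b + t * x \<in> C \<inter> {..<m}}"
      using sub ab ts by (auto simp: m_def add.commute)
    then show ?thesis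
      using ts by (subst emeasure_real_affine_preimage[where c=t and d="s*b"])
        (auto intro!: mult_left_mono emeasure_mono)
  qed
  have r: "ennreal s * emeasure lborel (B \<inter> {b..}) \<le> emeasure lborel (C \<inter> {m..})"
  proof -
    have "B \<inter> {b..} \<subseteq> {x. t * a + s * x \<in> C \<inter> {m..}}"
      using sub ab ts by (auto simp: m_def)
    then show ?thesis
      using ts by (subst emeasure_real_affine_preimage[where c=s and d="t*a"])
        (auto intro!: mult_left_mono emeasure_mono)
  qed
  have "emeasure lborel (C \<inter> {..<m}) + emeasure lborel (C \<inter> {m..})
      = emeasure lborel ((C \<inter> {..<m}) \<union> (C \<inter> {m..}))"
    by (intro plus_emeasure) auto
  also have "(C \<inter> {..<m}) \<union> (C \<inter> {m..}) = C" by auto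
  finally show ?thesis using add_mono[OF l r] by simp
qed

text \<open>Pivots near the supremum of \<open>A\<close> and near the infimum of \<open>B\<close> lose arbitrarily little measure.
  Working with near-extremal points instead of extremal ones avoids passing to compact subsets.\<close>

lemma brunn_minkowski_real_bounded:
  fixes A B C :: "real set"
  assumes [measurable]: "A \<in> sets borel" "B \<in> sets borel" "C \<in> sets borel"
    and ts: "0 < t" "0 < s" and ne: "A \<noteq> {}" "B \<noteq> {}" and bd: "bounded A" "bounded B"
    and sub: "\<And>x y. x \<in> A \<Longrightarrow> y \<in> B \<Longrightarrow> t * x + s * y \<in> C"
  shows "ennreal t * emeasure lborel A + ennreal s * emeasure lborel B \<le> emeasure lborel C"
proof (rule ennreal_le_epsilon)
  fix e :: real assume e: "0 < e"
  define d where "d = e / (t + s)"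
  have d: "d > 0" using e ts by (simp add: d_def)
  have bdA: "bdd_above A" and bdB: "bdd_below B"
    using bd by (auto intro: bounded_imp_bdd_above bounded_imp_bdd_below)
  obtain a where a: "a \<in> A" "Sup A - d < a"
    using less_cSupE[of "Sup A - d" A] ne d by auto
  obtain b where b: "b \<in> B" "b < Inf B + d"
    using cInf_lessD[of B "Inf B + d"] ne d by auto
  have A: "emeasure lborel A \<le> emeasure lborel (A \<inter> {..<a}) + ennreal d"
  proof -
    have "A \<subseteq> (A \<inter> {..<a}) \<union> {a..Sup A}"
      using cSup_upper[OF _ bdA] by force
    then have "emeasure lborel A \<le> emeasure lborel ((A \<inter> {..<a}) \<union> {a..Sup A})"
      by (intro emeasure_mono) auto
    also have "\<dots> \<le> emeasure lborel (A \<inter> {..<a}) + emeasure lborel {a..Sup A}"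
      by (intro emeasure_subadditive) auto
    also have "emeasure lborel {a..Sup A} \<le> ennreal d"
      using a cSup_upper[OF a(1) bdA] by (auto intro!: ennreal_leI)
    finally show ?thesis by simp
  qed
  have B: "emeasure lborel B \<le> emeasure lborel (B \<inter> {b..}) + ennreal d"
  proof -
    have "B \<subseteq> (B \<inter> {b..}) \<union> {Inf B..b}"
      using cInf_lower[OF _ bdB] by force
    then have "emeasure lborel B \<le> emeasure lborel ((B \<inter> {b..}) \<union> {Inf B..b})"
      by (intro emeasure_mono) auto
    also have "\<dots> \<le> emeasure lborel (B \<inter> {b..}) + emeasure lborel {Inf B..b}"
      by (intro emeasure_subadditive) auto
    also have "emeasure lborel {Inf B..b} \<le> ennreal d"
      using b cInf_lower[OF b(1) bdB] by (auto intro!: ennreal_leI)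
    finally show ?thesis by simp
  qed
  have "ennreal t * emeasure lborel A + ennreal s * emeasure lborel B
     \<le> ennreal t * (emeasure lborel (A \<inter> {..<a}) + ennreal d)
       + ennreal s * (emeasure lborel (B \<inter> {b..}) + ennreal d)"
    by (intro add_mono mult_left_mono A B) auto
  also have "\<dots> = (ennreal t * emeasure lborel (A \<inter> {..<a}) + ennreal s * emeasure lborel (B \<inter> {b..}))
       + (ennreal t * ennreal d + ennreal s * ennreal d)"
    by (simp add: distrib_left ac_simps)
  also have "ennreal t * ennreal d + ennreal s * ennreal d = ennreal e"
  proof -
    have "t * d + s * d = (t + s) * d" by (simp add: algebra_simps)
    also have "\<dots> = e" using ts by (simp add: d_def)
    finally show ?thesis using ts d by (simp flip: ennreal_mult ennreal_plus)
  qed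
  finally show "ennreal t * emeasure lborel A + ennreal s * emeasure lborel B
       \<le> emeasure lborel C + ennreal e"
    using brunn_minkowski_pivot[OF assms(1-3) ts a(1) b(1) sub] add_right_mono order_trans by blast
qed

lemma brunn_minkowski_real:
  fixes A B C :: "real set"
  assumes [measurable]: "A \<in> sets borel" "B \<in> sets borel" "C \<in> sets borel"
    and ts: "0 < t" "0 < s" and ne: "A \<noteq> {}" "B \<noteq> {}"
    and sub: "\<And>x y. x \<in> A \<Longrightarrow> y \<in> B \<Longrightarrow> t * x + s * y \<in> C"
  shows "ennreal t * emeasure lborel A + ennreal s * emeasure lborel B \<le> emeasure lborel C"
proof -
  have lim: "(\<lambda>n. emeasure lborel (S \<inter> {- real n..real n})) \<longlonglongrightarrow> emeasure lborel S"
    if [measurable]: "S \<in> sets borel" for S :: "real set"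
  proof -
    have "(\<lambda>n. emeasure lborel (S \<inter> {- real n..real n})) \<longlonglongrightarrow> emeasure lborel (\<Union>n. S \<inter> {- real n..real n})"
      by (intro Lim_emeasure_incseq) (auto simp: incseq_def)
    also have "(\<Union>n. S \<inter> {- real n..real n}) = S"
    proof safe
      fix x assume "x \<in> S"
      obtain n where "\<bar>x\<bar> \<le> real n" using real_arch_simple by blast
      then show "x \<in> (\<Union>n. S \<inter> {- real n..real n})" using \<open>x \<in> S\<close> by (auto simp: abs_le_iff intro!: exI[of _ n])
    qed
    finally show ?thesis .
  qed
  obtain a b where ab: "a \<in> A" "b \<in> B" using ne by auto
  obtain n0 where n0: "max \<bar>a\<bar> \<bar>b\<bar> \<le> real n0" using real_arch_simple by blast
  have "ennreal t * emeasure lborel (A \<inter> {- real n..real n}) + ennreal s * emeasure lborel (B \<inter> {- real n..real n})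
     \<le> emeasure lborel C" if "n \<ge> n0" for n
  proof (rule brunn_minkowski_real_bounded)
    have n: "max \<bar>a\<bar> \<bar>b\<bar> \<le> real n" using that n0 by linarith
    then have "a \<in> A \<inter> {- real n..real n}" "b \<in> B \<inter> {- real n..real n}"
      using ab by auto
    then show "A \<inter> {- real n..real n} \<noteq> {}" "B \<inter> {- real n..real n} \<noteq> {}"
      by blast+
  qed (use ts sub in \<open>auto intro: bounded_subset[OF bounded_closed_interval]\<close>)
  then show ?thesis
    by (intro LIMSEQ_le_const2[where X="\<lambda>n. ennreal t * emeasure lborel (A \<inter> {- real n..real n})
        + ennreal s * emeasure lborel (B \<inter> {- real n..real n})"] tendsto_add ennreal_tendsto_cmult lim)
      auto
qed

lemma weighted_am_gm:
  fixes a b t s :: real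
  assumes "0 < a" "0 < b" "0 < t" "0 < s" "t + s = 1"
  shows "a powr t * b powr s \<le> t * a + s * b"
proof -
  have t: "t = 1 - s" using assms by simp
  have "exp (t *\<^sub>R ln a + s *\<^sub>R ln b) \<le> t * exp (ln a) + s * exp (ln b)"
    unfolding t using assms by (intro convex_onD[OF exp_convex]) auto
  then show ?thesis using assms by (simp add: powr_def exp_add)
qed

text \<open>Stopping at level \<open>1\<close> allows the same formula to serve for functions bounded by \<open>1\<close>, where the
  minimum disappears, and for the function \<open>h\<close> on the large side of Prekopa-Leindler, where it only
  decreases the integral.\<close>

lemma layer_cake_unit:
  fixes f :: "real \<Rightarrow> ennreal"
  assumes [measurable]: "f \<in> borel_measurable borel"
  shows "(\<integral>\<^sup>+u. indicator {0<..<1} u * emeasure lborel {x. ennreal u < f x} \<partial>lborel)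
       = (\<integral>\<^sup>+x. min (f x) 1 \<partial>lborel)"
proof -
  have inner: "(\<integral>\<^sup>+u. indicator {0<..<1::real} u * indicator {u. ennreal u < v} u \<partial>lborel) = min v 1" for v
  proof (cases "v \<ge> 1")
    case True
    have "(\<integral>\<^sup>+u. indicator {0<..<1::real} u * indicator {u. ennreal u < v} u \<partial>lborel)
        = (\<integral>\<^sup>+u. indicator {0<..<1::real} u \<partial>lborel)"
    proof (intro nn_integral_cong)
      fix u :: real
      have "ennreal u < v" if "u < 1"
        using that True by (metis ennreal_less_one_iff less_le_trans)
      then show "indicator {0<..<1::real} u * indicator {u. ennreal u < v} u = (indicator {0<..<1} u :: ennreal)"
        by (auto simp: indicator_def)
    qed
    then show ?thesis using True by (simp add: min_absorb2)
  next
    case False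
    then obtain r where r: "v = ennreal r" "0 \<le> r" "r < 1"
      by (cases v) auto
    have "(\<integral>\<^sup>+u. indicator {0<..<1::real} u * indicator {u. ennreal u < v} u \<partial>lborel)
        = (\<integral>\<^sup>+u. indicator {0<..<r} u \<partial>lborel)"
      using r by (intro nn_integral_cong) (auto simp: indicator_def ennreal_less_iff)
    then show ?thesis using r False by (simp add: min_absorb1)
  qed
  have "(\<integral>\<^sup>+u. indicator {0<..<1} u * emeasure lborel {x. ennreal u < f x} \<partial>lborel)
     = (\<integral>\<^sup>+u. (\<integral>\<^sup>+x. indicator {0<..<1} u * indicator {u. ennreal u < f x} u \<partial>lborel) \<partial>lborel)"
  proof (intro nn_integral_cong)
    fix u :: real
    have "(\<integral>\<^sup>+x. indicator {0<..<1} u * indicator {u. ennreal u < f x} u \<partial>lborel)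
      = (\<integral>\<^sup>+x. indicator {0<..<1} u * indicator {x. ennreal u < f x} x \<partial>lborel)"
      by (intro nn_integral_cong) (auto simp: indicator_def)
    then show "indicator {0<..<1} u * emeasure lborel {x. ennreal u < f x}
      = (\<integral>\<^sup>+x. indicator {0<..<1} u * indicator {u. ennreal u < f x} u \<partial>lborel)"
      by (simp add: nn_integral_cmult)
  qed
  also have "\<dots> = (\<integral>\<^sup>+x. (\<integral>\<^sup>+u. indicator {0<..<1} u * indicator {u. ennreal u < f x} u \<partial>lborel) \<partial>lborel)"
    by (rule lborel_pair.Fubini') (simp add: split_beta', measurable)
  finally show ?thesis by (simp add: inner)
qed

text \<open>With both suprema normalised to \<open>1\<close>, the \<open>u\<close>-level sets of \<open>f\<close> and \<open>g\<close> are nonempty for the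
  same range of \<open>u\<close>, and their combination lies in that of \<open>h\<close>. Integrating Brunn-Minkowski over \<open>u\<close>
  even gives the arithmetic mean of the integrals on the left.\<close>

lemma prekopa_leindler_real_unit:
  fixes f g h :: "real \<Rightarrow> ennreal"
  assumes [measurable]: "f \<in> borel_measurable borel" "g \<in> borel_measurable borel" "h \<in> borel_measurable borel"
    and ts: "0 < t" "0 < s"
    and f1: "\<And>x. f x \<le> 1" and g1: "\<And>x. g x \<le> 1"
    and fS: "\<And>u::real. 0 < u \<Longrightarrow> u < 1 \<Longrightarrow> \<exists>x. ennreal u < f x"
    and gS: "\<And>u::real. 0 < u \<Longrightarrow> u < 1 \<Longrightarrow> \<exists>x. ennreal u < g x"
    and hyp: "\<And>x y (u::real). 0 < u \<Longrightarrow> u < 1 \<Longrightarrow> ennreal u < f x \<Longrightarrow> ennreal u < g y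
        \<Longrightarrow> ennreal u < h (t * x + s * y)"
  shows "ennreal t * (\<integral>\<^sup>+x. f x \<partial>lborel) + ennreal s * (\<integral>\<^sup>+x. g x \<partial>lborel) \<le> (\<integral>\<^sup>+x. h x \<partial>lborel)"
proof -
  let ?L = "\<lambda>f u. indicator {0<..<1} u * emeasure lborel {x. ennreal u < (f x :: ennreal)}"
  have meas: "?L q \<in> borel_measurable lborel" if [measurable]: "q \<in> borel_measurable borel" for q :: "real \<Rightarrow> ennreal"
  proof -
    have "(\<lambda>u. emeasure lborel {x. ennreal u < q x}) =
          (\<lambda>u. \<integral>\<^sup>+x. indicator {p. ennreal (fst p) < q (snd p)} (u, x) \<partial>lborel)"
      by (auto simp: fun_eq_iff nn_integral_indicator[symmetric] simp del: nn_integral_indicator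
           intro!: nn_integral_cong split: split_indicator)
    also have "\<dots> \<in> borel_measurable lborel" by measurable
    finally show ?thesis by measurable
  qed
  have "ennreal t * (\<integral>\<^sup>+x. f x \<partial>lborel) + ennreal s * (\<integral>\<^sup>+x. g x \<partial>lborel)
     = ennreal t * (\<integral>\<^sup>+x. min (f x) 1 \<partial>lborel) + ennreal s * (\<integral>\<^sup>+x. min (g x) 1 \<partial>lborel)"
    using f1 g1 by (simp add: min_absorb1)
  also have "\<dots> = (\<integral>\<^sup>+u. ennreal t * ?L f u + ennreal s * ?L g u \<partial>lborel)"
    by (subst nn_integral_add) (auto simp: nn_integral_cmult meas layer_cake_unit intro!: borel_measurable_times meas)
  also have "\<dots> \<le> (\<integral>\<^sup>+u. ?L h u \<partial>lborel)"
  proof (intro nn_integral_mono)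
    fix u :: real
    show "ennreal t * ?L f u + ennreal s * ?L g u \<le> ?L h u"
    proof (cases "0 < u \<and> u < 1")
      case True
      then have "ennreal t * emeasure lborel {x. ennreal u < f x} + ennreal s * emeasure lborel {x. ennreal u < g x}
         \<le> emeasure lborel {x. ennreal u < h x}"
        using fS gS hyp ts by (intro brunn_minkowski_real) auto
      then show ?thesis using True by simp
    qed auto
  qed
  also have "\<dots> = (\<integral>\<^sup>+x. min (h x) 1 \<partial>lborel)" by (rule layer_cake_unit) simp
  also have "\<dots> \<le> (\<integral>\<^sup>+x. h x \<partial>lborel)" by (intro nn_integral_mono) auto
  finally show ?thesis .
qed

text \<open>Dividing \<open>f\<close>, \<open>g\<close> by their suprema \<open>m\<close>, \<open>n\<close> and \<open>h\<close> by \<open>m powr t * n powr s\<close> preserves the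
  hypothesis and leads to the normalised case; the inequality between the arithmetic and the
  geometric mean then returns to the scale-invariant form. Hypothesis and conclusion speak of reals
  \<open>a\<close>, \<open>b\<close> strictly below the extended values: this expresses \<open>f x powr t * g y powr s \<le> h z\<close> without
  powers of \<open>\<infinity>\<close>, and the conclusion has the same shape, so that it can be iterated over coordinates.\<close>

lemma prekopa_leindler_real_bounded:
  fixes f g h :: "real \<Rightarrow> ennreal" and M :: real
  assumes [measurable]: "f \<in> borel_measurable borel" "g \<in> borel_measurable borel" "h \<in> borel_measurable borel"
    and ts: "0 < t" "0 < s" "t + s = 1"
    and fM: "\<And>x. f x \<le> ennreal M" and gM: "\<And>x. g x \<le> ennreal M"
    and hyp: "\<And>x y a b. 0 < a \<Longrightarrow> 0 < b \<Longrightarrow> ennreal a < f x \<Longrightarrow> ennreal b < g y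
        \<Longrightarrow> ennreal (a powr t * b powr s) \<le> h (t * x + s * y)"
    and ab: "0 < a" "0 < b" "ennreal a < (\<integral>\<^sup>+x. f x \<partial>lborel)" "ennreal b < (\<integral>\<^sup>+x. g x \<partial>lborel)"
  shows "ennreal (a powr t * b powr s) \<le> (\<integral>\<^sup>+x. h x \<partial>lborel)"
proof -
  have sup: "\<exists>m>0. (\<forall>x. q x \<le> ennreal m) \<and> (\<forall>u<1. \<exists>x. ennreal (u * m) < q x)"
    if qM: "\<And>x. q x \<le> ennreal M" and c: "0 < c" "ennreal c < (\<integral>\<^sup>+x. q x \<partial>lborel)"
    for q :: "real \<Rightarrow> ennreal" and c
  proof -
    define S where "S = (SUP x. q x)"
    have S_le: "S \<le> ennreal M" unfolding S_def by (rule SUP_least) (rule qM)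
    have up: "q x \<le> S" for x unfolding S_def by (rule SUP_upper) simp
    have "S \<noteq> 0"
    proof
      assume "S = 0"
      then have "q x = 0" for x using up[of x] by simp
      then show False using c by simp
    qed
    then obtain m where m: "S = ennreal m" "0 < m"
      using S_le by (cases S) (auto simp: top_unique)
    have "\<exists>x. ennreal (u * m) < q x" if "u < 1" for u
    proof -
      have "ennreal (u * m) < S" using m that by (simp add: ennreal_less_iff ennreal_lessI)
      then show ?thesis unfolding S_def by (auto simp: less_SUP_iff)
    qed
    then show ?thesis using m up by auto
  qed
  obtain m where m: "m > 0" "\<And>x. f x \<le> ennreal m" "\<And>u. u < 1 \<Longrightarrow> \<exists>x. ennreal (u * m) < f x"
    using sup[OF fM ab(1,3)] by auto
  obtain n where n: "n > 0" "\<And>x. g x \<le> ennreal n" "\<And>u. u < 1 \<Longrightarrow> \<exists>x. ennreal (u * n) < g x"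
    using sup[OF gM ab(2,4)] by auto
  define k where "k = m powr t * n powr s"
  have k: "k > 0" using m n by (simp add: k_def)
  have div_le: "q / ennreal c \<le> 1" if "q \<le> ennreal c" "c > 0" for q c
    using that by (simp add: divide_le_posI_ennreal)
  have less_div: "ennreal u < q / ennreal c \<longleftrightarrow> ennreal (u * c) < q" if "c > 0" "u > 0" for q c u
  proof (cases q)
    case (real r)
    then show ?thesis using that
      by (simp add: divide_ennreal ennreal_less_iff less_divide_eq)
  next
    case top
    then show ?thesis using that by (simp add: ennreal_top_divide)
  qed
  have "ennreal t * (\<integral>\<^sup>+x. f x / ennreal m \<partial>lborel) + ennreal s * (\<integral>\<^sup>+x. g x / ennreal n \<partial>lborel)
      \<le> (\<integral>\<^sup>+x. h x / ennreal k \<partial>lborel)"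
  proof (rule prekopa_leindler_real_unit)
    show "f x / ennreal m \<le> 1" "g x / ennreal n \<le> 1" for x
      using m n by (auto intro: div_le)
    show "\<exists>x. ennreal u < f x / ennreal m" "\<exists>x. ennreal u < g x / ennreal n" if "0 < u" "u < 1" for u
      using m n that by (auto simp: less_div)
  next
    fix x y u :: real
    assume u: "0 < u" "u < 1" "ennreal u < f x / ennreal m" "ennreal u < g y / ennreal n"
    \<comment> \<open>A single level just above \<open>u\<close>, used for both functions, makes the conclusion strict again.\<close>
    have "ennreal u < min (f x / ennreal m) (g y / ennreal n)" using u by simp
    then obtain w where w: "ennreal u < w" "w < min (f x / ennreal m) (g y / ennreal n)"
      using dense by blast
    then obtain v where v: "w = ennreal v" "u < v"
      using u by (cases w) (auto simp: ennreal_less_iff)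
    have v0: "v > 0" using u v by simp
    have "ennreal ((v * m) powr t * (v * n) powr s) \<le> h (t * x + s * y)"
      using w v0 m n v by (intro hyp) (auto simp: less_div)
    also have "(v * m) powr t * (v * n) powr s = (v powr t * v powr s) * k"
      using v0 m n by (simp add: powr_mult k_def)
    also have "v powr t * v powr s = v"
      using v0 ts by (simp flip: powr_add)
    finally have "ennreal (v * k) \<le> h (t * x + s * y)" .
    moreover have "ennreal (u * k) < ennreal (v * k)"
      using u v k by (intro ennreal_lessI) auto
    ultimately show "ennreal u < h (t * x + s * y) / ennreal k"
      using k u by (simp add: less_div)
  qed (use ts in auto)
  then have *: "ennreal t * ((\<integral>\<^sup>+x. f x \<partial>lborel) / ennreal m) + ennreal s * ((\<integral>\<^sup>+x. g x \<partial>lborel) / ennreal n)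
      \<le> (\<integral>\<^sup>+x. h x \<partial>lborel) / ennreal k"
    by (simp add: nn_integral_divide)
  have "a powr t * b powr s = k * ((a / m) powr t * (b / n) powr s)"
    using ab m n by (simp add: k_def powr_divide)
  also have "\<dots> \<le> k * (t * (a / m) + s * (b / n))"
    using ab m n ts k by (intro mult_left_mono weighted_am_gm) auto
  finally have "ennreal (a powr t * b powr s) \<le> ennreal (k * (t * (a / m) + s * (b / n)))"
    by (rule ennreal_leI)
  also have "\<dots> = ennreal k * (ennreal t * (ennreal a / ennreal m) + ennreal s * (ennreal b / ennreal n))"
    using ab m n ts k by (simp add: ennreal_mult ennreal_plus divide_ennreal del: times_divide_eq_right)
  also have "\<dots> \<le> ennreal k * ((\<integral>\<^sup>+x. h x \<partial>lborel) / ennreal k)"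
    using ab by (intro mult_left_mono order_trans[OF _ *] add_mono divide_right_mono_ennreal) auto
  also have "\<dots> = (\<integral>\<^sup>+x. h x \<partial>lborel)"
    using k by (subst mult.commute) (simp add: ennreal_divide_times ennreal_times_divide[symmetric] ennreal_divide_self)
  finally show ?thesis .
qed

lemma prekopa_leindler_real:
  fixes f g h :: "real \<Rightarrow> ennreal"
  assumes [measurable]: "f \<in> borel_measurable borel" "g \<in> borel_measurable borel" "h \<in> borel_measurable borel"
    and ts: "0 < t" "0 < s" "t + s = 1"
    and hyp: "\<And>x y a b. 0 < a \<Longrightarrow> 0 < b \<Longrightarrow> ennreal a < f x \<Longrightarrow> ennreal b < g y
        \<Longrightarrow> ennreal (a powr t * b powr s) \<le> h (t * x + s * y)"
    and ab: "0 < a" "0 < b" "ennreal a < (\<integral>\<^sup>+x. f x \<partial>lborel)" "ennreal b < (\<integral>\<^sup>+x. g x \<partial>lborel)"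
  shows "ennreal (a powr t * b powr s) \<le> (\<integral>\<^sup>+x. h x \<partial>lborel)"
proof -
  have SUP_min: "(SUP n. min v (ennreal (real n))) = v" for v :: ennreal
  proof -
    have "min v (SUP n. ennreal (real n)) = (SUP n. min v (ennreal (real n)))"
      using inf_Sup[of v "range (\<lambda>n. ennreal (real n))"]
      by (simp add: inf_min image_image)
    then show ?thesis by (simp add: ennreal_SUP_of_nat_eq_top flip: ennreal_of_nat_eq_real_of_nat)
  qed
  have trunc: "\<exists>n0. \<forall>n\<ge>n0. ennreal c < (\<integral>\<^sup>+x. min (q x) (ennreal (real n)) \<partial>lborel)"
    if [measurable]: "q \<in> borel_measurable borel" and c: "ennreal c < (\<integral>\<^sup>+x. q x \<partial>lborel)"
    for q :: "real \<Rightarrow> ennreal" and c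
  proof -
    have mono: "(\<integral>\<^sup>+x. min (q x) (ennreal (real n)) \<partial>lborel) \<le> (\<integral>\<^sup>+x. min (q x) (ennreal (real n')) \<partial>lborel)"
      if "n \<le> n'" for n n'
      using that by (intro nn_integral_mono min.mono ennreal_leI) auto
    have "(\<integral>\<^sup>+x. q x \<partial>lborel) = (\<integral>\<^sup>+x. (SUP n. min (q x) (ennreal (real n))) \<partial>lborel)"
      by (simp add: SUP_min)
    also have "\<dots> = (SUP n. (\<integral>\<^sup>+x. min (q x) (ennreal (real n)) \<partial>lborel))"
      by (intro nn_integral_monotone_convergence_SUP) (auto simp: incseq_def le_fun_def min_le_iff_disj intro!: ennreal_leI)
    finally obtain n where "ennreal c < (\<integral>\<^sup>+x. min (q x) (ennreal (real n)) \<partial>lborel)"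
      using c by (auto simp: less_SUP_iff)
    then show ?thesis using mono less_le_trans by blast
  qed
  obtain n1 n2 where
    "\<And>n. n \<ge> n1 \<Longrightarrow> ennreal a < (\<integral>\<^sup>+x. min (f x) (ennreal (real n)) \<partial>lborel)"
    "\<And>n. n \<ge> n2 \<Longrightarrow> ennreal b < (\<integral>\<^sup>+x. min (g x) (ennreal (real n)) \<partial>lborel)"
    using trunc[OF assms(1) ab(3)] trunc[OF assms(2) ab(4)] by auto
  then show ?thesis
    using ab hyp ts
    by (intro prekopa_leindler_real_bounded[where M="real (max n1 n2)" and
        f="\<lambda>x. min (f x) (ennreal (real (max n1 n2)))" and g="\<lambda>x. min (g x) (ennreal (real (max n1 n2)))"])
      auto
qed

lemma product_sigma_finite_lborel: "product_sigma_finite (\<lambda>_. lborel :: real measure)"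
  by (simp add: product_sigma_finite_def sigma_finite_lborel)

text \<open>Induction on the coordinates: by the induction hypothesis the integrals over the sections
  satisfy the one-dimensional hypothesis, and Tonelli's theorem reassembles the full integral.\<close>

theorem prekopa_leindler_PiM:
  fixes f g h :: "('i \<Rightarrow> real) \<Rightarrow> ennreal"
  assumes "finite I"
    and "f \<in> borel_measurable (config_lborel I)" "g \<in> borel_measurable (config_lborel I)"
      "h \<in> borel_measurable (config_lborel I)"
    and ts: "0 < t" "0 < s" "t + s = 1"
    and "\<And>x y a b. x \<in> config_space I \<Longrightarrow> y \<in> config_space I \<Longrightarrow> 0 < a \<Longrightarrow> 0 < b \<Longrightarrow>
        ennreal a < f x \<Longrightarrow> ennreal b < g y
        \<Longrightarrow> ennreal (a powr t * b powr s) \<le> h (\<lambda>i\<in>I. t * x i + s * y i)"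
    and "0 < a" "0 < b" "ennreal a < (\<integral>\<^sup>+x. f x \<partial>config_lborel I)" "ennreal b < (\<integral>\<^sup>+x. g x \<partial>config_lborel I)"
  shows "ennreal (a powr t * b powr s) \<le> (\<integral>\<^sup>+x. h x \<partial>config_lborel I)"
  using assms(1-4,8-)
proof (induction I arbitrary: f g h a b rule: finite_induct)
  case empty
  interpret product_sigma_finite "\<lambda>_. lborel :: real measure" by (rule product_sigma_finite_lborel)
  have "(\<lambda>i\<in>{}. t * undefined i + s * undefined i) = (\<lambda>_. undefined :: real)" by auto
  with empty.prems(4)[of "\<lambda>_. undefined" "\<lambda>_. undefined" a b] empty.prems(5-) show ?case
    by (simp add: nn_integral_empty restrict_def)
next
  case (insert i I)
  interpret product_sigma_finite "\<lambda>_. lborel :: real measure" by (rule product_sigma_finite_lborel)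
  note [measurable] = insert.prems(1-3)
  define S where "S q u = (\<integral>\<^sup>+x. q (x(i := u)) \<partial>config_lborel I)" for q :: "('i \<Rightarrow> real) \<Rightarrow> ennreal" and u :: real
  have int: "(\<integral>\<^sup>+x. q x \<partial>config_lborel (insert i I)) = (\<integral>\<^sup>+u. S q u \<partial>lborel)"
    if "q \<in> borel_measurable (config_lborel (insert i I))" for q
    unfolding S_def using insert.hyps that by (intro product_nn_integral_insert_rev) auto
  have sec: "(\<lambda>x. q (x(i := u))) \<in> borel_measurable (config_lborel I)"
    if [measurable]: "q \<in> borel_measurable (config_lborel (insert i I))" for q :: "('i \<Rightarrow> real) \<Rightarrow> ennreal" and u :: real
  proof -
    have "(\<lambda>x. x(i := u)) \<in> measurable (config_lborel I) (config_lborel (insert i I))"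
      by (rule measurable_fun_upd[where J=I]) auto
    then show ?thesis by measurable
  qed
  have Sm: "S q \<in> borel_measurable borel"
    if [measurable]: "q \<in> borel_measurable (config_lborel (insert i I))" for q :: "('i \<Rightarrow> real) \<Rightarrow> ennreal"
  proof -
    interpret I: sigma_finite_measure "config_lborel I" by (intro sigma_finite insert.hyps)
    show ?thesis unfolding S_def by measurable
  qed
  have "ennreal (a powr t * b powr s) \<le> (\<integral>\<^sup>+u. S h u \<partial>lborel)"
  proof (rule prekopa_leindler_real[OF Sm Sm Sm ts])
    fix x y a b :: real
    assume ab: "0 < a" "0 < b" "ennreal a < S f x" "ennreal b < S g y"
    show "ennreal (a powr t * b powr s) \<le> S h (t * x + s * y)"
      unfolding S_def
    proof (rule insert.IH[OF sec sec sec])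
      fix p q :: "'i \<Rightarrow> real" and a b :: real
      assume pq: "p \<in> config_space I" "q \<in> config_space I" "0 < a" "0 < b"
        "ennreal a < f (p(i := x))" "ennreal b < g (q(i := y))"
      have "(\<lambda>j\<in>insert i I. t * (p(i := x)) j + s * (q(i := y)) j)
          = (\<lambda>j\<in>I. t * p j + s * q j)(i := t * x + s * y)"
        using insert.hyps by (auto simp: fun_eq_iff restrict_def)
      moreover have "p(i := x) \<in> config_space (insert i I)" "q(i := y) \<in> config_space (insert i I)"
        using pq by (auto simp: PiE_fun_upd)
      ultimately show "ennreal (a powr t * b powr s) \<le> h ((\<lambda>j\<in>I. t * p j + s * q j)(i := t * x + s * y))"
        using insert.prems(4)[of "p(i:=x)" "q(i:=y)" a b] pq by metis
    qed (use ab insert.prems(1-3) in \<open>simp_all only: S_def\<close>)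
  qed (use insert.prems in \<open>auto simp: int\<close>)
  then show ?case by (simp add: int)
qed

section \<open>Differential calculus on configuration space\<close>

lemma config_upd: "x \<in> config_space \<Lambda> \<Longrightarrow> i \<in> \<Lambda> \<Longrightarrow> x(i := t) \<in> config_space \<Lambda>"
  by (auto simp: PiE_def extensional_def)

lemma closed_config_space: "closed (config_space \<Lambda>)"
proof -
  have "config_space \<Lambda> = (\<Inter>i\<in>-\<Lambda>. {x. x i = (undefined :: real)})"
    by (auto simp: PiE_def extensional_def)
  then show ?thesis by (auto intro!: closed_INT closed_Collect_eq)
qed

text \<open>The topology is that of the full function space, whereas the measure lives on a finite
  product. For a countable index type, the inclusion of the latter in the former is Borel measurable
  coordinate by coordinate.\<close>

lemma measurable_continuous_config:
  fixes p :: "('i::countable \<Rightarrow> real) \<Rightarrow> real"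
  assumes "continuous_on (config_space \<Lambda>) p"
  shows "p \<in> borel_measurable (config_lborel \<Lambda>)"
proof -
  have id: "(\<lambda>x. x) \<in> measurable (config_lborel \<Lambda>) (borel :: ('i \<Rightarrow> real) measure)"
  proof (rule measurable_coordinatewise_then_product)
    fix i
    show "(\<lambda>x. x i) \<in> measurable (config_lborel \<Lambda>) (borel :: real measure)"
    proof (cases "i \<in> \<Lambda>")
      case False
      have "(\<lambda>x. x i) \<in> measurable (config_lborel \<Lambda>) (borel :: real measure)
          \<longleftrightarrow> (\<lambda>x. undefined) \<in> measurable (config_lborel \<Lambda>) (borel :: real measure)"
        using False by (intro measurable_cong) (auto simp: space_PiM PiE_def extensional_def)
      then show ?thesis by simp
    qed measurable
  qed
  have "(\<lambda>x. indicator (config_space \<Lambda>) x *\<^sub>R p x) \<in> borel_measurable borel"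
    using assms by (intro borel_measurable_continuous_on_indicator borel_closed closed_config_space)
  from measurable_compose[OF id this]
  have "(\<lambda>x. indicator (config_space \<Lambda>) x *\<^sub>R p x) \<in> borel_measurable (config_lborel \<Lambda>)" .
  also have "?this \<longleftrightarrow> ?thesis"
    by (intro measurable_cong) (auto simp: space_PiM)
  finally show ?thesis .
qed

lemma smooth_fun_continuous: "smooth_fun \<Lambda> f \<Longrightarrow> continuous_on (config_space \<Lambda>) f"
  unfolding smooth_fun_def by (drule bspec[of _ _ "[]"]) auto

lemma smooth_fun_partial_deriv:
  assumes "smooth_fun \<Lambda> f" "i \<in> \<Lambda>"
  shows "smooth_fun \<Lambda> (partial_deriv i f)"
  unfolding smooth_fun_def
proof
  fix js assume "js \<in> lists \<Lambda>"
  then have "i # js \<in> lists \<Lambda>" using assms by simp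
  with assms(1) have "continuous_on (config_space \<Lambda>) (fold partial_deriv (i # js) f) \<and>
        (\<forall>j\<in>\<Lambda>. \<forall>x\<in>config_space \<Lambda>.
           (\<lambda>t. fold partial_deriv (i # js) f (x(j := t))) differentiable (at (x j)))"
    unfolding smooth_fun_def by blast
  then show "continuous_on (config_space \<Lambda>) (fold partial_deriv js (partial_deriv i f)) \<and>
        (\<forall>j\<in>\<Lambda>. \<forall>x\<in>config_space \<Lambda>.
           (\<lambda>t. fold partial_deriv js (partial_deriv i f) (x(j := t))) differentiable (at (x j)))"
    by simp
qed

lemma smooth_fun_DERIV:
  assumes "smooth_fun \<Lambda> f" "x \<in> config_space \<Lambda>" "i \<in> \<Lambda>"
  shows "((\<lambda>t. f (x(i := t))) has_real_derivative partial_deriv i f (x(i := s))) (at s)"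
proof -
  have "\<forall>i\<in>\<Lambda>. \<forall>x\<in>config_space \<Lambda>. (\<lambda>t. f (x(i := t))) differentiable (at (x i))"
    using assms(1) unfolding smooth_fun_def by (drule_tac bspec[of _ _ "[]"]) auto
  from this[rule_format, of i "x(i := s)"] assms
  have "(\<lambda>t. f (x(i := t))) differentiable (at s)" by (simp add: config_upd)
  then show ?thesis
    by (simp add: partial_deriv_def DERIV_deriv_iff_real_differentiable)
qed

lemma partial_deriv_eqI:
  assumes "((\<lambda>t. f (x(i := t))) has_real_derivative D) (at (x i))"
  shows "partial_deriv i f x = D"
  using assms by (simp add: partial_deriv_def DERIV_imp_deriv)

lemma test_funs_smooth: "f \<in> test_funs \<Lambda> \<Longrightarrow> smooth_fun \<Lambda> f"
  by (simp add: test_funs_def)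

text \<open>A partial derivative vanishes at every point off the closed support of \<open>f\<close>, because near it
  the coordinate line through that point stays off the support.\<close>

lemma test_funs_partial_deriv:
  assumes f: "f \<in> test_funs \<Lambda>" and i: "i \<in> \<Lambda>"
  shows "partial_deriv i f \<in> test_funs \<Lambda>"
proof -
  define K where "K = closure {x \<in> config_space \<Lambda>. f x \<noteq> 0}"
  have K: "compact K" using f by (simp add: test_funs_def K_def)
  have "partial_deriv i f x = 0" if x: "x \<in> config_space \<Lambda>" "x \<notin> K" for x
  proof -
    define S where "S = (\<lambda>t. x(i := t)) -` (- K)"
    have S: "open S" unfolding S_def
    proof (rule open_vimage)
      show "open (- K)" by (simp add: K_def open_Compl)
      show "continuous_on UNIV (\<lambda>t. x(i := t))"
      proof (intro continuous_on_coordinatewise_then_product)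
        show "continuous_on UNIV (\<lambda>t. (x(i := t)) j)" for j
          by (cases "j = i") (auto simp: continuous_on_id)
      qed
    qed
    have xS: "x i \<in> S" using x by (simp add: S_def)
    have 0: "f (x(i := t)) = 0" if "t \<in> S" for t
    proof (rule ccontr)
      assume "f (x(i := t)) \<noteq> 0"
      then have "x(i := t) \<in> {x \<in> config_space \<Lambda>. f x \<noteq> 0}"
        using config_upd[OF x(1) i] by simp
      then have "x(i := t) \<in> K" unfolding K_def by (rule subsetD[OF closure_subset])
      then show False using that by (simp add: S_def)
    qed
    have "((\<lambda>t. 0) has_real_derivative 0) (at (x i))" by simp
    then have "((\<lambda>t. f (x(i := t))) has_real_derivative 0) (at (x i))"
      by (rule has_field_derivative_transform_within_open[OF _ S xS]) (simp add: 0)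
    then show ?thesis by (rule partial_deriv_eqI)
  qed
  then have "{x \<in> config_space \<Lambda>. partial_deriv i f x \<noteq> 0} \<subseteq> K" by auto
  then have "closure {x \<in> config_space \<Lambda>. partial_deriv i f x \<noteq> 0} \<subseteq> K"
    by (rule closure_minimal) (simp add: K_def)
  then have "compact (closure {x \<in> config_space \<Lambda>. partial_deriv i f x \<noteq> 0})"
    using compact_Int_closed[OF K closed_closure, of "{x \<in> config_space \<Lambda>. partial_deriv i f x \<noteq> 0}"]
    by (simp add: inf.absorb2)
  then show ?thesis using f i by (simp add: test_funs_def smooth_fun_partial_deriv)
qed

lemma test_funs_bounded:
  assumes f: "f \<in> test_funs \<Lambda>"
  obtains B where "B > 0" "\<And>x. x \<in> config_space \<Lambda> \<Longrightarrow> \<bar>f x\<bar> \<le> B"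
proof -
  define K where "K = closure {x \<in> config_space \<Lambda>. f x \<noteq> 0}"
  have K: "compact K" using f by (simp add: test_funs_def K_def)
  have "K \<subseteq> config_space \<Lambda>"
    unfolding K_def by (intro closure_minimal closed_config_space) auto
  then have "continuous_on K f"
    using smooth_fun_continuous[OF test_funs_smooth[OF f]] continuous_on_subset by blast
  then have "bounded (f ` K)"
    using K by (intro compact_imp_bounded compact_continuous_image)
  then obtain B where B: "B > 0" "\<And>x. x \<in> K \<Longrightarrow> \<bar>f x\<bar> \<le> B"
    by (auto simp: bounded_pos)
  have "\<bar>f x\<bar> \<le> B" if "x \<in> config_space \<Lambda>" for x
  proof (cases "f x = 0")
    case True
    then show ?thesis using B by simp
  next
    case False
    then have "x \<in> {x \<in> config_space \<Lambda>. f x \<noteq> 0}" using that by simp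
    then have "x \<in> K" unfolding K_def by (rule subsetD[OF closure_subset])
    then show ?thesis by (rule B)
  qed
  then show ?thesis using that B(1) by blast
qed

lemma test_funs_measurable:
  fixes f :: "('i::countable \<Rightarrow> real) \<Rightarrow> real"
  shows "f \<in> test_funs \<Lambda> \<Longrightarrow> f \<in> borel_measurable (config_lborel \<Lambda>)"
  by (intro measurable_continuous_config smooth_fun_continuous test_funs_smooth)

text \<open>Changing the coordinates from \<open>z\<close> to \<open>x\<close> one at a time stays in the box spanned by the two
  points, and each change is controlled by the mean value theorem in one variable.\<close>

lemma box_mean_value:
  assumes fin: "finite \<Lambda>" and f: "smooth_fun \<Lambda> f" and x: "x \<in> config_space \<Lambda>" and z: "z \<in> config_space \<Lambda>"
    and B: "\<And>y i. i \<in> \<Lambda> \<Longrightarrow> y \<in> config_space \<Lambda> \<Longrightarrow> (\<And>j. j \<in> \<Lambda> \<Longrightarrow> \<bar>y j - z j\<bar> \<le> \<bar>x j - z j\<bar>)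
        \<Longrightarrow> \<bar>partial_deriv i f y\<bar> \<le> B i"
  shows "\<bar>f x - f z\<bar> \<le> (\<Sum>i\<in>\<Lambda>. B i * \<bar>x i - z i\<bar>)"
proof -
  define Y where "Y S = (\<lambda>j. if j \<in> S then x j else z j)" for S
  have Y: "Y S \<in> config_space \<Lambda>" for S
    using x z by (auto simp: Y_def PiE_def extensional_def)
  have "\<bar>f (Y S) - f z\<bar> \<le> (\<Sum>i\<in>S. B i * \<bar>x i - z i\<bar>)" if "S \<subseteq> \<Lambda>" for S
    using finite_subset[OF that fin] that
  proof (induction S rule: finite_induct)
    case empty
    then show ?case by (simp add: Y_def)
  next
    case (insert i S)
    have i: "i \<in> \<Lambda>" using insert by simp
    have upd: "Y (insert i S) = (Y S)(i := x i)" "Y S = (Y S)(i := z i)"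
      using insert.hyps by (auto simp: Y_def)
    have "norm (f ((Y S)(i := x i)) - f ((Y S)(i := z i))) \<le> B i * norm (x i - z i)"
    proof (rule field_differentiable_bound[where S="closed_segment (z i) (x i)"])
      fix s assume s: "s \<in> closed_segment (z i) (x i)"
      show "((\<lambda>t. f ((Y S)(i := t))) has_field_derivative partial_deriv i f ((Y S)(i := s)))
          (at s within closed_segment (z i) (x i))"
        by (rule has_field_derivative_at_within) (rule smooth_fun_DERIV[OF f Y i])
      have "\<bar>s - z i\<bar> \<le> \<bar>x i - z i\<bar>"
        using s by (auto simp: closed_segment_eq_real_ivl split: if_splits)
      then show "norm (partial_deriv i f ((Y S)(i := s))) \<le> B i"
        unfolding real_norm_def by (intro B i config_upd Y) (auto simp: Y_def)
    qed auto
    then have "\<bar>f (Y (insert i S)) - f (Y S)\<bar> \<le> B i * \<bar>x i - z i\<bar>"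
      using upd by simp
    moreover have "\<bar>f (Y S) - f z\<bar> \<le> (\<Sum>i\<in>S. B i * \<bar>x i - z i\<bar>)"
      using insert by simp
    ultimately show ?case using insert.hyps by simp
  qed
  from this[of \<Lambda>] have "\<bar>f (Y \<Lambda>) - f z\<bar> \<le> (\<Sum>i\<in>\<Lambda>. B i * \<bar>x i - z i\<bar>)" by simp
  also have "Y \<Lambda> = x" using x z by (auto simp: Y_def PiE_def extensional_def fun_eq_iff)
  finally show ?thesis .
qed

text \<open>First-order Taylor expansion with an error that is uniform in the base point: the second
  partial derivatives are bounded, so the gradient varies by at most \<open>e\<close> in a small box around \<open>z\<close>.\<close>

lemma test_funs_uniform_gradient:
  assumes fin: "finite \<Lambda>" and f: "f \<in> test_funs \<Lambda>" and e: "e > 0"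
  obtains \<eta> where "\<eta> > 0"
    "\<And>x z. x \<in> config_space \<Lambda> \<Longrightarrow> z \<in> config_space \<Lambda> \<Longrightarrow> (\<And>j. j \<in> \<Lambda> \<Longrightarrow> \<bar>x j - z j\<bar> \<le> \<eta>) \<Longrightarrow>
       \<bar>f x - f z\<bar> \<le> (\<Sum>i\<in>\<Lambda>. (\<bar>partial_deriv i f z\<bar> + e) * \<bar>x i - z i\<bar>)"
proof -
  have "\<exists>B>0. \<forall>y\<in>config_space \<Lambda>. \<bar>partial_deriv j (partial_deriv i f) y\<bar> \<le> B"
    if "i \<in> \<Lambda>" "j \<in> \<Lambda>" for i j
    using test_funs_bounded[OF test_funs_partial_deriv[OF test_funs_partial_deriv[OF f that(1)] that(2)]] by metis
  then obtain b where b: "\<And>i j. i \<in> \<Lambda> \<Longrightarrow> j \<in> \<Lambda> \<Longrightarrow> b i j > 0"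
    "\<And>i j y. i \<in> \<Lambda> \<Longrightarrow> j \<in> \<Lambda> \<Longrightarrow> y \<in> config_space \<Lambda> \<Longrightarrow> \<bar>partial_deriv j (partial_deriv i f) y\<bar> \<le> b i j"
    by metis
  define C where "C = 1 + (\<Sum>i\<in>\<Lambda>. \<Sum>j\<in>\<Lambda>. b i j)"
  have sum_pos: "(\<Sum>j\<in>\<Lambda>. b i j) \<ge> 0" if "i \<in> \<Lambda>" for i
    using b(1)[OF that] by (intro sum_nonneg less_imp_le)
  have C: "C > 0" "\<And>i. i \<in> \<Lambda> \<Longrightarrow> (\<Sum>j\<in>\<Lambda>. b i j) \<le> C"
  proof -
    have "(\<Sum>i\<in>\<Lambda>. \<Sum>j\<in>\<Lambda>. b i j) \<ge> 0" by (rule sum_nonneg) (rule sum_pos)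
    then show "C > 0" by (simp add: C_def)
    fix i assume "i \<in> \<Lambda>"
    then have "(\<Sum>j\<in>\<Lambda>. b i j) \<le> (\<Sum>i\<in>\<Lambda>. \<Sum>j\<in>\<Lambda>. b i j)"
      using sum_pos fin by (intro member_le_sum[where f="\<lambda>i. \<Sum>j\<in>\<Lambda>. b i j"]) auto
    then show "(\<Sum>j\<in>\<Lambda>. b i j) \<le> C" by (simp add: C_def)
  qed
  define \<eta> where "\<eta> = e / C"
  have eta: "\<eta> > 0" using e C by (simp add: \<eta>_def)
  show ?thesis
  proof (rule that[OF eta])
    fix x z assume xz: "x \<in> config_space \<Lambda>" "z \<in> config_space \<Lambda>" "\<And>j. j \<in> \<Lambda> \<Longrightarrow> \<bar>x j - z j\<bar> \<le> \<eta>"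
    show "\<bar>f x - f z\<bar> \<le> (\<Sum>i\<in>\<Lambda>. (\<bar>partial_deriv i f z\<bar> + e) * \<bar>x i - z i\<bar>)"
    proof (rule box_mean_value[OF fin test_funs_smooth[OF f] xz(1,2)])
      fix y i assume y: "i \<in> \<Lambda>" "y \<in> config_space \<Lambda>" "\<And>j. j \<in> \<Lambda> \<Longrightarrow> \<bar>y j - z j\<bar> \<le> \<bar>x j - z j\<bar>"
      have "\<bar>partial_deriv i f y - partial_deriv i f z\<bar> \<le> (\<Sum>j\<in>\<Lambda>. b i j * \<bar>y j - z j\<bar>)"
        by (rule box_mean_value[OF fin test_funs_smooth[OF test_funs_partial_deriv[OF f y(1)]] y(2) xz(2)])
          (rule b(2)[OF y(1)])
      also have "\<dots> \<le> (\<Sum>j\<in>\<Lambda>. b i j * \<eta>)"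
        by (intro sum_mono mult_left_mono order_trans[OF y(3) xz(3)] less_imp_le[OF b(1)[OF y(1)]])
      also have "\<dots> \<le> C * \<eta>"
        using C(2)[OF y(1)] eta by (simp add: sum_distrib_right[symmetric])
      also have "\<dots> = e" using C by (simp add: \<eta>_def)
      finally show "\<bar>partial_deriv i f y\<bar> \<le> \<bar>partial_deriv i f z\<bar> + e" by linarith
    qed
  qed
qed

section \<open>Gibbs measures and the logarithmic Sobolev inequality\<close>

text \<open>The bounds on the partition function say that normalising \<open>exp (- U)\<close> gives a probability
  measure.\<close>

locale gibbs_potential =
  fixes \<Lambda> :: "'i::countable set" and U :: "('i \<Rightarrow> real) \<Rightarrow> real"
  assumes fin: "finite \<Lambda>"
    and U_meas [measurable]: "U \<in> borel_measurable (config_lborel \<Lambda>)"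
    and Z_pos: "partition_fun \<Lambda> U > 0" and Z_fin: "partition_fun \<Lambda> U < \<infinity>"
begin

abbreviation "\<mu> \<equiv> gibbs \<Lambda> U"

definition \<rho> where "\<rho> x = exp (- U x) / enn2real (partition_fun \<Lambda> U)"

lemma Z_real_pos: "enn2real (partition_fun \<Lambda> U) > 0"
  using Z_pos Z_fin by (simp add: enn2real_positive_iff)

lemma \<rho>_pos: "\<rho> x > 0"
  using Z_real_pos by (simp add: \<rho>_def)

lemma \<rho>_meas [measurable]: "\<rho> \<in> borel_measurable (config_lborel \<Lambda>)"
  unfolding \<rho>_def by measurable

lemma ennreal_\<rho>: "ennreal (exp (- U x)) / partition_fun \<Lambda> U = ennreal (\<rho> x)"
proof -
  have "partition_fun \<Lambda> U = ennreal (enn2real (partition_fun \<Lambda> U))"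
    using Z_fin by (simp add: less_top)
  then show ?thesis
    using Z_real_pos by (metis \<rho>_def divide_ennreal exp_ge_zero)
qed

lemma gibbs_eq: "\<mu> = density (config_lborel \<Lambda>) (\<lambda>x. ennreal (\<rho> x))"
  by (simp add: gibbs_def ennreal_\<rho>)

lemma sets_gibbs [measurable_cong, simp]: "sets \<mu> = sets (config_lborel \<Lambda>)"
  by (simp add: gibbs_eq)

lemma space_gibbs [simp]: "space \<mu> = config_space \<Lambda>"
  by (simp add: gibbs_eq space_PiM)

sublocale prob_space \<mu>
proof
  have "emeasure \<mu> (space \<mu>) = (\<integral>\<^sup>+x. ennreal (exp (- U x)) / partition_fun \<Lambda> U \<partial>config_lborel \<Lambda>)"
    unfolding gibbs_def space_density
    by (subst emeasure_density) (auto intro!: nn_integral_cong)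
  also have "\<dots> = partition_fun \<Lambda> U / partition_fun \<Lambda> U"
    by (subst nn_integral_divide) (auto simp: partition_fun_def)
  also have "\<dots> = 1" using Z_pos Z_fin by (simp add: ennreal_divide_self)
  finally show "emeasure \<mu> (space \<mu>) = 1" .
qed

lemma integrable_bounded:
  fixes f :: "('i \<Rightarrow> real) \<Rightarrow> real"
  assumes "f \<in> borel_measurable (config_lborel \<Lambda>)" "\<And>x. x \<in> config_space \<Lambda> \<Longrightarrow> \<bar>f x\<bar> \<le> B"
  shows "integrable \<mu> f"
  using assms by (intro integrable_const_bound[of _ B]) (auto simp: measurable_cong_sets[OF sets_gibbs refl])

lemma integral_mono_config:
  fixes f g :: "('i \<Rightarrow> real) \<Rightarrow> real"
  assumes "integrable \<mu> f" "integrable \<mu> g" "\<And>x. x \<in> config_space \<Lambda> \<Longrightarrow> f x \<le> g x"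
  shows "(\<integral>x. f x \<partial>\<mu>) \<le> (\<integral>x. g x \<partial>\<mu>)"
  using assms by (intro integral_mono) auto

text \<open>Prekopa-Leindler for the functions \<open>F \<rho>\<close>, \<open>\<rho>\<close> and \<open>Q \<rho>\<close>. The middle one integrates to \<open>1\<close>, so
  only the integrals of \<open>F\<close> and \<open>Q\<close> remain, and the convexity defect of \<open>U\<close> becomes a gain in the
  hypothesis.\<close>

lemma prekopa_leindler_gibbs:
  fixes F Q :: "('i \<Rightarrow> real) \<Rightarrow> real"
  assumes F: "integrable \<mu> F" "\<And>x. x \<in> config_space \<Lambda> \<Longrightarrow> 0 \<le> F x"
    and Q: "integrable \<mu> Q" "\<And>x. x \<in> config_space \<Lambda> \<Longrightarrow> 0 \<le> Q x"
    and ts: "0 < t" "0 < s" "t + s = 1"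
    and hyp: "\<And>x y. x \<in> config_space \<Lambda> \<Longrightarrow> y \<in> config_space \<Lambda> \<Longrightarrow>
       F x powr t * exp (- (t * U x + s * U y - U (\<lambda>i\<in>\<Lambda>. t * x i + s * y i))) \<le> Q (\<lambda>i\<in>\<Lambda>. t * x i + s * y i)"
  shows "(\<integral>x. F x \<partial>\<mu>) powr t \<le> (\<integral>x. Q x \<partial>\<mu>)"
proof -
  define A where "A = (\<integral>x. F x \<partial>\<mu>)"
  define Z where "Z = enn2real (partition_fun \<Lambda> U)"
  have Z: "Z > 0" using Z_real_pos by (simp add: Z_def)
  have Q0: "0 \<le> (\<integral>x. Q x \<partial>\<mu>)" using Q by (intro integral_nonneg_AE) auto
  have A0: "0 \<le> A" unfolding A_def using F by (intro integral_nonneg_AE) auto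
  have [measurable]: "F \<in> borel_measurable (config_lborel \<Lambda>)" "Q \<in> borel_measurable (config_lborel \<Lambda>)"
    using borel_measurable_integrable[OF F(1)] borel_measurable_integrable[OF Q(1)]
    by (simp_all add: measurable_cong_sets[OF sets_gibbs refl])
  have int: "(\<integral>\<^sup>+x. ennreal (q x * \<rho> x) \<partial>config_lborel \<Lambda>) = ennreal (\<integral>x. q x \<partial>\<mu>)"
    if q: "integrable \<mu> q" "\<And>x. x \<in> config_space \<Lambda> \<Longrightarrow> 0 \<le> q x" for q
  proof -
    have [measurable]: "q \<in> borel_measurable (config_lborel \<Lambda>)"
      using borel_measurable_integrable[OF q(1)] by (simp add: measurable_cong_sets[OF sets_gibbs refl])
    have "ennreal (\<integral>x. q x \<partial>\<mu>) = (\<integral>\<^sup>+x. ennreal (q x) \<partial>\<mu>)"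
      using q by (intro nn_integral_eq_integral[symmetric]) auto
    also have "\<dots> = (\<integral>\<^sup>+x. ennreal (\<rho> x) * ennreal (q x) \<partial>config_lborel \<Lambda>)"
      unfolding gibbs_eq by (intro nn_integral_density) auto
    also have "\<dots> = (\<integral>\<^sup>+x. ennreal (q x * \<rho> x) \<partial>config_lborel \<Lambda>)"
      using q \<rho>_pos by (intro nn_integral_cong)
        (auto simp: space_PiM ennreal_mult[symmetric] less_imp_le mult.commute)
    finally show ?thesis ..
  qed
  have key: "r * A powr t \<le> (\<integral>x. Q x \<partial>\<mu>)" if r: "0 < r" "r < 1" and A: "A > 0" for r
  proof -
    have "ennreal ((r * A) powr t * r powr s) \<le> (\<integral>\<^sup>+x. ennreal (Q x * \<rho> x) \<partial>config_lborel \<Lambda>)"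
    proof (rule prekopa_leindler_PiM[OF fin _ _ _ ts])
      show "ennreal (r * A) < (\<integral>\<^sup>+x. ennreal (F x * \<rho> x) \<partial>config_lborel \<Lambda>)"
        using A r by (subst int[OF F]) (auto simp: A_def[symmetric] ennreal_less_iff)
      show "ennreal r < (\<integral>\<^sup>+x. ennreal (1 * \<rho> x) \<partial>config_lborel \<Lambda>)"
      proof -
        have "(\<integral>\<^sup>+x. ennreal (1 * \<rho> x) \<partial>config_lborel \<Lambda>) = ennreal (\<integral>x. 1 \<partial>\<mu>)"
          by (rule int) auto
        also have "(\<integral>x. 1 \<partial>\<mu>) = (1::real)" by (simp add: prob_space[unfolded space_gibbs])
        finally show ?thesis using r by (simp add: ennreal_less_iff)
      qed
    next
      fix x y :: "'i \<Rightarrow> real" and a b :: real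
      assume xy: "x \<in> config_space \<Lambda>" "y \<in> config_space \<Lambda>" and ab: "0 < a" "0 < b"
        "ennreal a < ennreal (F x * \<rho> x)" "ennreal b < ennreal (1 * \<rho> y)"
      define z where "z = (\<lambda>i\<in>\<Lambda>. t * x i + s * y i)"
      have "a powr t * b powr s \<le> (F x * \<rho> x) powr t * \<rho> y powr s"
        using ab ts by (intro mult_mono powr_mono2) (auto simp: ennreal_less_iff less_imp_le)
      also have "\<dots> = F x powr t * (\<rho> x powr t * \<rho> y powr s)"
        using F(2)[OF xy(1)] \<rho>_pos[of x] by (simp add: powr_mult)
      also have "\<rho> x powr t * \<rho> y powr s = exp (- (t * U x + s * U y)) / (Z powr t * Z powr s)"
        using Z by (simp add: \<rho>_def Z_def[symmetric] powr_divide exp_powr_real mult_exp_exp algebra_simps)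
      also have "Z powr t * Z powr s = Z" using Z ts by (simp flip: powr_add)
      also have "F x powr t * (exp (- (t * U x + s * U y)) / Z)
          = (F x powr t * exp (- (t * U x + s * U y - U z))) * \<rho> z"
        by (simp add: \<rho>_def Z_def[symmetric] mult_exp_exp)
      also have "\<dots> \<le> Q z * \<rho> z"
        using hyp[OF xy] \<rho>_pos[of z] by (intro mult_right_mono) (auto simp: z_def less_imp_le)
      finally show "ennreal (a powr t * b powr s) \<le> ennreal (Q z * \<rho> z)"
        by (rule ennreal_leI)
    qed (use r A in auto)
    also have "\<dots> = ennreal (\<integral>x. Q x \<partial>\<mu>)" by (rule int[OF Q])
    finally have "(r * A) powr t * r powr s \<le> (\<integral>x. Q x \<partial>\<mu>)" using Q0 by simp
    moreover have "(r * A) powr t * r powr s = (r powr t * r powr s) * A powr t"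
      using r A by (simp add: powr_mult)
    moreover have "r powr t * r powr s = r" using r ts by (simp flip: powr_add)
    ultimately show ?thesis by simp
  qed
  show ?thesis
  proof (cases "A = 0")
    case True
    then show ?thesis using Q0 by (simp add: A_def)
  next
    case False
    then have "A > 0" using A0 by simp
    show ?thesis unfolding A_def[symmetric]
      by (rule field_le_mult_one_interval) (rule key[OF _ _ \<open>A > 0\<close>])
  qed
qed

end

text \<open>Close to \<open>z\<close>, Taylor expansion bounds \<open>\<bar>f x\<bar>\<close> by \<open>\<bar>f z\<bar> + \<nu> r\<close>, where \<open>\<nu>\<close> is the norm of the enlarged
  gradient and \<open>r\<close> the distance of \<open>x\<close> and \<open>z\<close>. Cauchy-Schwarz in the form
  \<open>(a + \<nu> r)\<^sup>2 \<le> (a\<^sup>2 + \<tau> \<nu>\<^sup>2) (1 + r\<^sup>2 / \<tau>)\<close> and \<open>1 + v \<le> exp v\<close> then give the claim with the sharp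
  coefficient of \<open>\<nu>\<^sup>2\<close>. Away from \<open>z\<close>, the Gaussian factor is so small for small \<open>\<tau>\<close> that the
  constant \<open>d\<close> on the right suffices; this is what the shift by \<open>d > 0\<close> is for.\<close>

lemma gaussian_sup_convolution:
  fixes f :: "('i::countable \<Rightarrow> real) \<Rightarrow> real"
  assumes fin: "finite \<Lambda>" and f: "f \<in> test_funs \<Lambda>" and e: "e > 0" and d: "d > 0"
  obtains \<tau>0 where "\<tau>0 > 0"
    "\<And>\<tau> x z. 0 < \<tau> \<Longrightarrow> \<tau> < \<tau>0 \<Longrightarrow> x \<in> config_space \<Lambda> \<Longrightarrow> z \<in> config_space \<Lambda> \<Longrightarrow>
      ((f x)\<^sup>2 + d) * exp (- (\<Sum>i\<in>\<Lambda>. (x i - z i)\<^sup>2) / \<tau>)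
        \<le> (f z)\<^sup>2 + d + \<tau> * (\<Sum>i\<in>\<Lambda>. (\<bar>partial_deriv i f z\<bar> + e)\<^sup>2)"
proof -
  obtain M where M: "M > 0" "\<And>x. x \<in> config_space \<Lambda> \<Longrightarrow> \<bar>f x\<bar> \<le> M"
    using test_funs_bounded[OF f] by blast
  obtain \<eta> where \<eta>: "\<eta> > 0"
    "\<And>x z. x \<in> config_space \<Lambda> \<Longrightarrow> z \<in> config_space \<Lambda> \<Longrightarrow> (\<And>j. j \<in> \<Lambda> \<Longrightarrow> \<bar>x j - z j\<bar> \<le> \<eta>) \<Longrightarrow>
       \<bar>f x - f z\<bar> \<le> (\<Sum>i\<in>\<Lambda>. (\<bar>partial_deriv i f z\<bar> + e) * \<bar>x i - z i\<bar>)"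
    using test_funs_uniform_gradient[OF fin f e] by blast
  \<comment> \<open>Chosen so that \<open>(M\<^sup>2 + d) exp (- \<eta>\<^sup>2 / \<tau>) \<le> d\<close> for all \<open>\<tau> < \<tau>0\<close>.\<close>
  define \<tau>0 where "\<tau>0 = d * \<eta>\<^sup>2 / (M\<^sup>2 + d)"
  have Md: "M\<^sup>2 + d > 0" using d by (simp add: add_nonneg_pos)
  have \<tau>0: "\<tau>0 > 0" using d \<eta>(1) Md by (simp add: \<tau>0_def)
  have exp_neg: "exp (- v) \<le> 1 / (1 + v)" if "v \<ge> 0" for v :: real
    using exp_ge_add_one_self[of v] that by (simp add: exp_minus field_simps)
  show ?thesis
  proof (rule that[OF \<tau>0])
    fix \<tau> and x z :: "'i \<Rightarrow> real"
    assume \<tau>: "0 < \<tau>" "\<tau> < \<tau>0" and x: "x \<in> config_space \<Lambda>" and z: "z \<in> config_space \<Lambda>"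
    define H where "H = (\<Sum>i\<in>\<Lambda>. (x i - z i)\<^sup>2)"
    define N where "N = (\<Sum>i\<in>\<Lambda>. (\<bar>partial_deriv i f z\<bar> + e)\<^sup>2)"
    have H0: "H \<ge> 0" and N0: "N \<ge> 0" by (auto simp: H_def N_def intro: sum_nonneg)
    have "((f x)\<^sup>2 + d) * exp (- H / \<tau>) \<le> (f z)\<^sup>2 + d + \<tau> * N"
    proof (cases "\<forall>j\<in>\<Lambda>. \<bar>x j - z j\<bar> \<le> \<eta>")
      case True
      have "\<bar>f x\<bar> \<le> \<bar>f z\<bar> + (\<Sum>i\<in>\<Lambda>. (\<bar>partial_deriv i f z\<bar> + e) * \<bar>x i - z i\<bar>)"
        using \<eta>(2)[OF x z] True by force
      also have "(\<Sum>i\<in>\<Lambda>. (\<bar>partial_deriv i f z\<bar> + e) * \<bar>x i - z i\<bar>) \<le> sqrt N * sqrt H"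
        using L2_set_mult_ineq[of "\<lambda>i. \<bar>partial_deriv i f z\<bar> + e" "\<lambda>i. \<bar>x i - z i\<bar>" \<Lambda>] e
        by (simp add: L2_set_def N_def H_def)
      finally have le: "\<bar>f x\<bar> \<le> \<bar>f z\<bar> + sqrt N * sqrt H" by simp
      have "(f x)\<^sup>2 \<le> (\<bar>f z\<bar> + sqrt N * sqrt H)\<^sup>2"
        using power_mono[OF le, of 2] by simp
      also have "\<dots> = (f z)\<^sup>2 + N * H + 2 * (\<bar>f z\<bar> * sqrt H) * sqrt N"
        using N0 H0 by (simp add: power2_sum power_mult_distrib)
      also have "2 * (\<bar>f z\<bar> * sqrt H) * sqrt N \<le> (\<bar>f z\<bar> * sqrt H)\<^sup>2 / \<tau> + \<tau> * (sqrt N)\<^sup>2"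
      proof -
        have "0 \<le> (\<bar>f z\<bar> * sqrt H - \<tau> * sqrt N)\<^sup>2 / \<tau>" using \<tau> by simp
        also have "\<dots> = (\<bar>f z\<bar> * sqrt H)\<^sup>2 / \<tau> + \<tau> * (sqrt N)\<^sup>2 - 2 * (\<bar>f z\<bar> * sqrt H) * sqrt N"
          using \<tau> by (simp add: power2_diff field_simps power2_eq_square)
        finally show ?thesis by simp
      qed
      also have "(\<bar>f z\<bar> * sqrt H)\<^sup>2 / \<tau> + \<tau> * (sqrt N)\<^sup>2 = (f z)\<^sup>2 * H / \<tau> + \<tau> * N"
        using N0 H0 by (simp add: power_mult_distrib)
      finally have fx: "(f x)\<^sup>2 \<le> (f z)\<^sup>2 + N * H + ((f z)\<^sup>2 * H / \<tau> + \<tau> * N)" by simp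
      have "(f x)\<^sup>2 + d \<le> (f z)\<^sup>2 + N * H + ((f z)\<^sup>2 * H / \<tau> + \<tau> * N) + d * (1 + H / \<tau>)"
      proof -
        have "0 \<le> d * (H / \<tau>)" using d H0 \<tau> by simp
        then show ?thesis using fx by (simp add: distrib_left)
      qed
      also have "\<dots> = ((f z)\<^sup>2 + d + \<tau> * N) * (1 + H / \<tau>)"
        using \<tau> by (simp add: field_simps)
      finally have "((f x)\<^sup>2 + d) * exp (- H / \<tau>) \<le> ((f z)\<^sup>2 + d + \<tau> * N) * (1 + H / \<tau>) * exp (- (H / \<tau>))"
        by (simp add: mult_right_mono)
      also have "\<dots> \<le> ((f z)\<^sup>2 + d + \<tau> * N) * (1 + H / \<tau>) * (1 / (1 + H / \<tau>))"
        using d \<tau> N0 H0 by (intro mult_left_mono exp_neg) auto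
      also have "\<dots> = (f z)\<^sup>2 + d + \<tau> * N"
      proof -
        have "1 + H / \<tau> > 0" using H0 \<tau> by (simp add: add_pos_nonneg)
        then show ?thesis by simp
      qed
      finally show ?thesis .
    next
      case False
      then obtain j where j: "j \<in> \<Lambda>" "\<eta> < \<bar>x j - z j\<bar>" by force
      have "\<eta>\<^sup>2 \<le> \<bar>x j - z j\<bar>\<^sup>2" using j \<eta>(1) by (intro power_mono) auto
      also have "\<dots> \<le> H" unfolding H_def power2_abs
        using j fin by (intro member_le_sum[where f="\<lambda>i. (x i - z i)\<^sup>2"]) auto
      finally have H: "\<eta>\<^sup>2 \<le> H" .
      have Hp: "H > 0" using H \<eta>(1) by (meson less_le_trans zero_less_power)
      have "(f x)\<^sup>2 \<le> M\<^sup>2" using M(2)[OF x] by (metis abs_ge_zero power2_abs power_mono)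
      then have "((f x)\<^sup>2 + d) * exp (- H / \<tau>) \<le> (M\<^sup>2 + d) * (1 / (1 + H / \<tau>))"
        using exp_neg[of "H / \<tau>"] H0 \<tau> d by (intro mult_mono) auto
      also have "\<dots> \<le> (M\<^sup>2 + d) * (\<tau> / H)"
        using Hp \<tau> Md by (intro mult_left_mono) (auto simp: field_simps add_pos_pos)
      also have "\<dots> \<le> (M\<^sup>2 + d) * (\<tau>0 / \<eta>\<^sup>2)"
        using H Hp \<tau> Md \<eta>(1) by (intro mult_left_mono frac_le) auto
      also have "\<dots> = d" using Md \<eta>(1) by (simp add: \<tau>0_def)
      also have "d \<le> (f z)\<^sup>2 + d + \<tau> * N" using \<tau> N0 by simp
      finally show ?thesis .
    qed
    then show "((f x)\<^sup>2 + d) * exp (- (\<Sum>i\<in>\<Lambda>. (x i - z i)\<^sup>2) / \<tau>)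
        \<le> (f z)\<^sup>2 + d + \<tau> * (\<Sum>i\<in>\<Lambda>. (\<bar>partial_deriv i f z\<bar> + e)\<^sup>2)"
      by (simp add: H_def N_def)
  qed
qed


lemma x_ln_x_continuous_on: "continuous_on {0..} (\<lambda>x::real. x * ln x)"
proof -
  have "((\<lambda>x::real. x * ln x) \<longlongrightarrow> 0 * ln 0) (at 0 within {0..})"
  proof -
    have "((\<lambda>x::real. x * ln x) \<longlongrightarrow> 0) (at_right 0)" by real_asymp
    then show ?thesis by (simp add: at_within_Ici_at_right)
  qed
  moreover have "((\<lambda>x::real. x * ln x) \<longlongrightarrow> y * ln y) (at y within {0..})" if "y > 0" for y
    using that by (intro tendsto_intros) auto
  ultimately show ?thesis
    unfolding continuous_on_def by (metis atLeast_iff order_le_less)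
qed

text \<open>Adding the constant \<open>d\<close> to \<open>f\<^sup>2\<close> lowers the integral of \<open>f\<^sup>2 ln f\<^sup>2\<close> by at most \<open>- d ln d\<close>, which
  tends to \<open>0\<close> with \<open>d\<close>.\<close>

lemma x_ln_x_superadditive:
  fixes x d :: real
  assumes "0 \<le> x" "0 < d"
  shows "x * ln x + d * ln d \<le> (x + d) * ln (x + d)"
proof -
  have "x * ln x \<le> x * ln (x + d)"
    using assms by (cases "x = 0") (auto intro!: mult_left_mono)
  moreover have "d * ln d \<le> d * ln (x + d)"
    using assms by (auto intro!: mult_left_mono)
  ultimately show ?thesis by (simp add: distrib_right)
qed

text \<open>Both sides of the hypothesis agree at \<open>p = 1\<close>, so their derivatives there are ordered in the
  same way: \<open>E\<close> on the left, \<open>m ln m + d\<close> on the right.\<close>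

lemma entropy_bound_from_norm_bound:
  fixes m d E pmax :: real
  assumes m: "m > 0" and pmax: "pmax > 1"
    and le: "\<And>p. 1 < p \<Longrightarrow> p < pmax \<Longrightarrow> m + (p - 1) * E \<le> (m + (p - 1) * d) powr p"
  shows "E \<le> m * ln m + d"
proof (rule ccontr)
  assume "\<not> ?thesis"
  then have neg: "m * ln m + d - E < 0" by simp
  define k where "k p = (m + (p - 1) * d) powr p - (m + (p - 1) * E)" for p
  have "(k has_real_derivative (m * ln m + d - E)) (at 1)"
  proof -
    have "((\<lambda>p. m + (p - 1) * d) has_real_derivative d) (at 1)"
      by (auto intro!: derivative_eq_intros)
    from DERIV_powr[OF this _ DERIV_ident]
    have "((\<lambda>p. (m + (p - 1) * d) powr p) has_real_derivative m * ln m + d) (at 1)"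
      using m by (simp add: algebra_simps)
    moreover have "((\<lambda>p. m + (p - 1) * E) has_real_derivative E) (at 1)"
      by (auto intro!: derivative_eq_intros)
    ultimately show ?thesis unfolding k_def by (rule DERIV_diff)
  qed
  from has_real_derivative_neg_dec_right[of k _ _ UNIV, OF this neg]
  obtain h where h: "h > 0" "\<And>q. 0 < q \<Longrightarrow> q < h \<Longrightarrow> k (1 + q) < k 1" by auto
  define q where "q = min (h / 2) ((pmax - 1) / 2)"
  have q: "0 < q" "q < h" "1 + q < pmax" using h(1) pmax by (auto simp: q_def min_def field_simps)
  have "k (1 + q) < 0" using h(2)[OF q(1,2)] m by (simp add: k_def)
  moreover have "k (1 + q) \<ge> 0" using le[of "1 + q"] q by (simp add: k_def)
  ultimately show False by simp
qed

lemma continuous_bounded_on_interval: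
  fixes \<phi> :: "real \<Rightarrow> real"
  assumes \<phi>: "continuous_on UNIV \<phi>"
  obtains C where "\<And>y. \<bar>y\<bar> \<le> B \<Longrightarrow> \<bar>\<phi> y\<bar> \<le> C"
proof -
  have "compact (\<phi> ` {-B..B})"
    using \<phi> by (intro compact_continuous_image) (auto intro: continuous_on_subset)
  then have "bounded (\<phi> ` {-B..B})" by (rule compact_imp_bounded)
  then obtain C where C: "\<forall>z \<in> \<phi> ` {-B..B}. norm z \<le> C" unfolding bounded_iff by blast
  show ?thesis
  proof (rule that)
    fix y assume "\<bar>y\<bar> \<le> B"
    then have "y \<in> {-B..B}" by auto
    then show "\<bar>\<phi> y\<bar> \<le> C" using C by auto
  qed
qed

context gibbs_potential
begin

lemma test_funs_integrable_comp:
  fixes f :: "('i \<Rightarrow> real) \<Rightarrow> real" and \<phi> :: "real \<Rightarrow> real"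
  assumes f: "f \<in> test_funs \<Lambda>" and \<phi>: "continuous_on UNIV \<phi>"
  shows "integrable \<mu> (\<lambda>x. \<phi> (f x))"
proof -
  obtain M where M: "M > 0" "\<And>x. x \<in> config_space \<Lambda> \<Longrightarrow> \<bar>f x\<bar> \<le> M"
    using test_funs_bounded[OF f] by blast
  obtain B where B: "\<And>y. \<bar>y\<bar> \<le> M \<Longrightarrow> \<bar>\<phi> y\<bar> \<le> B"
    by (rule continuous_bounded_on_interval[OF \<phi>, of M]) (rule that)
  have [measurable]: "f \<in> borel_measurable (config_lborel \<Lambda>)" by (rule test_funs_measurable[OF f])
  have [measurable]: "\<phi> \<in> borel_measurable borel" by (rule borel_measurable_continuous_onI[OF \<phi>])
  show ?thesis
  proof (rule integrable_bounded)
    show "\<bar>\<phi> (f x)\<bar> \<le> B" if "x \<in> config_space \<Lambda>" for x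
      by (intro B M(2) that)
  qed measurable
qed

text \<open>The logarithmic Sobolev inequality for uniformly convex potentials. Prekopa-Leindler with
  \<open>t = 1 / p\<close> compares the \<open>p\<close>-norm of \<open>G = f\<^sup>2 + d\<close> with the integral of its Gaussian
  sup-convolution at time \<open>\<tau> = (p - 1) / \<alpha>\<close>, which to first order is \<open>G + \<tau> \<bar>\<nabla>f\<bar>\<^sup>2\<close>. At \<open>p = 1\<close> this is
  an equality; its derivative in \<open>p\<close> is the entropy on one side and the Dirichlet form divided by
  \<open>\<alpha>\<close> on the other. At the end the auxiliary parameters \<open>d\<close> and \<open>e\<close> tend to \<open>0\<close> together.\<close>

theorem log_sobolev_uniformly_convex:
  assumes \<alpha>: "\<alpha> > 0"
    and convex: "\<And>x y t s. x \<in> config_space \<Lambda> \<Longrightarrow> y \<in> config_space \<Lambda> \<Longrightarrow> 0 < t \<Longrightarrow> 0 < s \<Longrightarrow> t + s = 1 \<Longrightarrow>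
      \<alpha> * t * s * (\<Sum>i\<in>\<Lambda>. (x i - y i)\<^sup>2) \<le> t * U x + s * U y - U (\<lambda>i\<in>\<Lambda>. t * x i + s * y i)"
    and f: "f \<in> test_funs \<Lambda>"
  shows "\<alpha> * Ent \<mu> (\<lambda>x. (f x)\<^sup>2) \<le> dirichlet \<Lambda> U f"
proof -
  define D where "D e = (\<integral>x. (\<Sum>i\<in>\<Lambda>. (\<bar>partial_deriv i f x\<bar> + e)\<^sup>2) \<partial>\<mu>)" for e
  define m0 where "m0 = (\<integral>x. (f x)\<^sup>2 \<partial>\<mu>)"
  define E0 where "E0 = (\<integral>x. (f x)\<^sup>2 * ln ((f x)\<^sup>2) \<partial>\<mu>)"
  have m0: "m0 \<ge> 0" unfolding m0_def by (intro integral_nonneg_AE) auto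
  have int_grad: "integrable \<mu> (\<lambda>x. \<phi> (partial_deriv i f x))"
    if "i \<in> \<Lambda>" "continuous_on UNIV \<phi>" for i and \<phi> :: "real \<Rightarrow> real"
    by (rule test_funs_integrable_comp[OF test_funs_partial_deriv[OF f that(1)] that(2)])
  have int_D: "integrable \<mu> (\<lambda>x. (\<Sum>i\<in>\<Lambda>. (\<bar>partial_deriv i f x\<bar> + e)\<^sup>2))" for e
    by (intro Bochner_Integration.integrable_sum int_grad[of _ "\<lambda>y. (\<bar>y\<bar> + e)\<^sup>2"] continuous_intros)
  have int_f2: "integrable \<mu> (\<lambda>x. (f x)\<^sup>2)"
    by (intro test_funs_integrable_comp[OF f, where \<phi>="\<lambda>y. y\<^sup>2"] continuous_intros)
  have cont_xlnx: "continuous_on UNIV (\<lambda>y::real. y\<^sup>2 * ln (y\<^sup>2))"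
    by (rule continuous_on_compose2[OF x_ln_x_continuous_on, where f="\<lambda>y. y\<^sup>2"])
      (auto intro!: continuous_intros)
  have int_E0: "integrable \<mu> (\<lambda>x. (f x)\<^sup>2 * ln ((f x)\<^sup>2))"
    by (rule test_funs_integrable_comp[OF f cont_xlnx])
  have core: "E0 + d * ln d \<le> (m0 + d) * ln (m0 + d) + D e / \<alpha>" if d: "d > 0" and e: "e > 0" for d e
  proof -
    let ?G = "\<lambda>x. (f x)\<^sup>2 + d"
    have Gpos: "?G x > 0" for x using d by (simp add: add_nonneg_pos)
    obtain \<tau>0 where \<tau>0: "\<tau>0 > 0"
      "\<And>\<tau> x z. 0 < \<tau> \<Longrightarrow> \<tau> < \<tau>0 \<Longrightarrow> x \<in> config_space \<Lambda> \<Longrightarrow> z \<in> config_space \<Lambda> \<Longrightarrow>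
      ?G x * exp (- (\<Sum>i\<in>\<Lambda>. (x i - z i)\<^sup>2) / \<tau>)
        \<le> ?G z + \<tau> * (\<Sum>i\<in>\<Lambda>. (\<bar>partial_deriv i f z\<bar> + e)\<^sup>2)"
      by (rule gaussian_sup_convolution[OF fin f e d]) (rule that)
    define m where "m = m0 + d"
    define E where "E = (\<integral>x. ?G x * ln (?G x) \<partial>\<mu>)"
    have m: "m > 0" using m0 d by (simp add: m_def)
    have int_G: "(\<integral>x. ?G x \<partial>\<mu>) = m"
      using int_f2 by (simp add: m_def m0_def prob_space[unfolded space_gibbs])
    have int_Gln: "integrable \<mu> (\<lambda>x. ?G x * ln (?G x))"
      by (intro test_funs_integrable_comp[OF f, where \<phi>="\<lambda>y. (y\<^sup>2 + d) * ln (y\<^sup>2 + d)"] continuous_intros)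
        (use d in \<open>auto simp: add_nonneg_eq_0_iff\<close>)
    have "E \<le> m * ln m + D e / \<alpha>"
    proof (rule entropy_bound_from_norm_bound[OF m, where pmax="1 + \<alpha> * \<tau>0"])
      show "1 + \<alpha> * \<tau>0 > 1" using \<alpha> \<tau>0 by simp
    next
      fix p assume p: "1 < p" "p < 1 + \<alpha> * \<tau>0"
      \<comment> \<open>The choice of \<open>t\<close> turns \<open>G powr p\<close> back into \<open>G\<close>; then \<open>\<tau>\<close> is the width of the Gaussian penalty
        \<open>exp (- \<alpha> t s \<bar>x - y\<bar>\<^sup>2)\<close> in terms of \<open>x - z = s (x - y)\<close>.\<close>
      define t where "t = 1 / p"
      define s where "s = 1 - t"
      define \<tau> where "\<tau> = (p - 1) / \<alpha>"
      have ts: "0 < t" "0 < s" "t + s = 1" using p by (auto simp: t_def s_def field_simps)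
      have \<tau>: "0 < \<tau>" "\<tau> < \<tau>0" using p \<alpha> by (auto simp: \<tau>_def field_simps)
      have st: "s = \<alpha> * \<tau> * t" using p \<alpha> by (simp add: s_def t_def \<tau>_def field_simps)
      let ?Q = "\<lambda>z. ?G z + \<tau> * (\<Sum>i\<in>\<Lambda>. (\<bar>partial_deriv i f z\<bar> + e)\<^sup>2)"
      have int_Gp: "integrable \<mu> (\<lambda>x. ?G x powr p)"
        by (intro test_funs_integrable_comp[OF f, where \<phi>="\<lambda>y. (y\<^sup>2 + d) powr p"] continuous_intros)
          (use d in \<open>auto simp: add_nonneg_eq_0_iff\<close>)
      have "(\<integral>x. ?G x powr p \<partial>\<mu>) powr t \<le> (\<integral>x. ?Q x \<partial>\<mu>)"
      proof (rule prekopa_leindler_gibbs[OF int_Gp _ _ _ ts])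
        show "integrable \<mu> ?Q"
          by (intro Bochner_Integration.integrable_add integrable_mult_right int_f2 int_D) auto
        show "0 \<le> ?Q x" for x
          using d \<tau> by (intro add_nonneg_nonneg mult_nonneg_nonneg sum_nonneg) auto
        show "0 \<le> ?G x powr p" for x by simp
      next
        fix x y assume xy: "x \<in> config_space \<Lambda>" "y \<in> config_space \<Lambda>"
        define z where "z = (\<lambda>i\<in>\<Lambda>. t * x i + s * y i)"
        have z: "z \<in> config_space \<Lambda>" by (simp add: z_def)
        have "(?G x powr p) powr t = ?G x"
          using Gpos[of x] p by (simp add: powr_powr t_def)
        moreover have "exp (- (t * U x + s * U y - U z)) \<le> exp (- (\<Sum>i\<in>\<Lambda>. (x i - z i)\<^sup>2) / \<tau>)"
        proof -
          have t: "t = 1 - s" using ts by simp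
          have "x i - z i = s * (x i - y i)" if "i \<in> \<Lambda>" for i
            using that by (simp add: z_def t algebra_simps)
          then have "(\<Sum>i\<in>\<Lambda>. (x i - z i)\<^sup>2) = (\<Sum>i\<in>\<Lambda>. s\<^sup>2 * (x i - y i)\<^sup>2)"
            by (intro sum.cong refl) (simp add: power_mult_distrib)
          then have "(\<Sum>i\<in>\<Lambda>. (x i - z i)\<^sup>2) = s\<^sup>2 * (\<Sum>i\<in>\<Lambda>. (x i - y i)\<^sup>2)"
            by (simp only: sum_distrib_left)
          then have "(\<Sum>i\<in>\<Lambda>. (x i - z i)\<^sup>2) / \<tau> = (s / \<tau>) * s * (\<Sum>i\<in>\<Lambda>. (x i - y i)\<^sup>2)"
            by (simp add: power2_eq_square)
          also have "s / \<tau> = \<alpha> * t" using st \<tau> by simp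
          finally show ?thesis using convex[OF xy ts] by (simp add: z_def)
        qed
        ultimately have "(?G x powr p) powr t * exp (- (t * U x + s * U y - U z))
            \<le> ?G x * exp (- (\<Sum>i\<in>\<Lambda>. (x i - z i)\<^sup>2) / \<tau>)"
          using Gpos[of x] by (simp add: mult_left_mono)
        also have "\<dots> \<le> ?Q z" by (rule \<tau>0(2)[OF \<tau> xy(1) z])
        finally show "(?G x powr p) powr t *
            exp (- (t * U x + s * U y - U (\<lambda>i\<in>\<Lambda>. t * x i + s * y i))) \<le> ?Q (\<lambda>i\<in>\<Lambda>. t * x i + s * y i)"
          unfolding z_def .
      qed
      also have "(\<integral>x. ?Q x \<partial>\<mu>) = m + (p - 1) * (D e / \<alpha>)"
        by (subst Bochner_Integration.integral_add)
          (auto simp: int_f2 int_D int_G D_def[symmetric] \<tau>_def)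
      finally have 1: "(\<integral>x. ?G x powr p \<partial>\<mu>) powr t \<le> m + (p - 1) * (D e / \<alpha>)" .
      have "(\<integral>x. ?G x powr p \<partial>\<mu>) = ((\<integral>x. ?G x powr p \<partial>\<mu>) powr t) powr p"
        using p by (simp add: powr_powr t_def integral_nonneg_AE)
      also have "\<dots> \<le> (m + (p - 1) * (D e / \<alpha>)) powr p"
        using 1 p by (intro powr_mono2) auto
      finally have 2: "(\<integral>x. ?G x powr p \<partial>\<mu>) \<le> (m + (p - 1) * (D e / \<alpha>)) powr p" .
      \<comment> \<open>The tangent inequality \<open>1 + v \<le> exp v\<close> replaces differentiation in \<open>p\<close> under the integral.\<close>
      have "m + (p - 1) * E = (\<integral>x. ?G x + (p - 1) * (?G x * ln (?G x)) \<partial>\<mu>)"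
        using int_f2 int_Gln by (subst Bochner_Integration.integral_add) (auto simp: int_G E_def)
      also have "\<dots> \<le> (\<integral>x. ?G x powr p \<partial>\<mu>)"
      proof (rule integral_mono_config[OF _ int_Gp])
        show "integrable \<mu> (\<lambda>x. ?G x + (p - 1) * (?G x * ln (?G x)))"
          using int_f2 int_Gln by auto
        fix x
        have "?G x + (p - 1) * (?G x * ln (?G x)) = ?G x * (1 + (p - 1) * ln (?G x))"
          by (simp add: algebra_simps)
        also have "\<dots> \<le> ?G x * exp ((p - 1) * ln (?G x))"
          using Gpos[of x] by (intro mult_left_mono exp_ge_add_one_self) auto
        also have "\<dots> = ?G x powr 1 * ?G x powr (p - 1)"
          using Gpos[of x] by (simp add: powr_def)
        also have "\<dots> = ?G x powr p" by (simp only: powr_add[symmetric]) simp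
        finally show "?G x + (p - 1) * (?G x * ln (?G x)) \<le> ?G x powr p" .
      qed
      finally show "m + (p - 1) * E \<le> (m + (p - 1) * (D e / \<alpha>)) powr p" using 2 by linarith
    qed
    moreover have "E0 + d * ln d \<le> E"
    proof -
      have "E0 + d * ln d = (\<integral>x. (f x)\<^sup>2 * ln ((f x)\<^sup>2) + d * ln d \<partial>\<mu>)"
        using int_E0 by (simp add: E0_def prob_space[unfolded space_gibbs])
      also have "\<dots> \<le> E" unfolding E_def
      proof (rule integral_mono_config[OF _ int_Gln])
        show "integrable \<mu> (\<lambda>x. (f x)\<^sup>2 * ln ((f x)\<^sup>2) + d * ln d)"
          using int_E0 by simp
        show "(f x)\<^sup>2 * ln ((f x)\<^sup>2) + d * ln d \<le> ?G x * ln (?G x)" for x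
          using d by (intro x_ln_x_superadditive) auto
      qed
      finally show ?thesis .
    qed
    ultimately show ?thesis by (simp add: m_def)
  qed
  have D_lim: "(D \<longlongrightarrow> D 0) (at_right 0)"
  proof -
    define a where "a = (\<integral>x. (\<Sum>i\<in>\<Lambda>. \<bar>partial_deriv i f x\<bar>) \<partial>\<mu>)"
    have int_a: "integrable \<mu> (\<lambda>x. (\<Sum>i\<in>\<Lambda>. \<bar>partial_deriv i f x\<bar>))"
      by (intro Bochner_Integration.integrable_sum int_grad[of _ abs] continuous_intros)
    have "D e = D 0 + 2 * e * a + e\<^sup>2 * card \<Lambda>" for e
    proof -
      let ?q = "\<lambda>x. \<Sum>i\<in>\<Lambda>. (\<bar>partial_deriv i f x\<bar> + 0)\<^sup>2" and ?a = "\<lambda>x. \<Sum>i\<in>\<Lambda>. \<bar>partial_deriv i f x\<bar>"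
      have "(\<Sum>i\<in>\<Lambda>. (\<bar>partial_deriv i f x\<bar> + e)\<^sup>2) = ?q x + 2 * e * ?a x + e\<^sup>2 * card \<Lambda>" for x
        by (simp add: power2_sum sum.distrib sum_distrib_left mult_ac)
      then have "D e = (\<integral>x. ?q x + 2 * e * ?a x + e\<^sup>2 * card \<Lambda> \<partial>\<mu>)"
        by (simp only: D_def)
      also have "\<dots> = (\<integral>x. ?q x + 2 * e * ?a x \<partial>\<mu>) + (\<integral>x. e\<^sup>2 * card \<Lambda> \<partial>\<mu>)"
        by (intro Bochner_Integration.integral_add Bochner_Integration.integrable_add int_D
            integrable_mult_right int_a integrable_const)
      also have "(\<integral>x. ?q x + 2 * e * ?a x \<partial>\<mu>) = D 0 + 2 * e * a"
        unfolding D_def a_def integral_mult_right_zero[symmetric]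
        by (intro Bochner_Integration.integral_add int_D integrable_mult_right int_a)
      also have "(\<integral>x. e\<^sup>2 * card \<Lambda> \<partial>\<mu>) = e\<^sup>2 * card \<Lambda>"
        by (simp add: prob_space[unfolded space_gibbs])
      finally show ?thesis .
    qed
    then have D_eq: "D = (\<lambda>e. D 0 + 2 * e * a + e\<^sup>2 * card \<Lambda>)" by (rule ext)
    have "((\<lambda>e. D 0 + 2 * e * a + e\<^sup>2 * card \<Lambda>) \<longlongrightarrow> D 0 + 2 * 0 * a + 0\<^sup>2 * real (card \<Lambda>)) (at_right 0)"
      by (intro tendsto_intros)
    then have "((\<lambda>e. D 0 + 2 * e * a + e\<^sup>2 * card \<Lambda>) \<longlongrightarrow> D 0) (at_right 0)" by simp
    then show ?thesis by (rule back_subst[of "\<lambda>g. (g \<longlongrightarrow> D 0) (at_right 0)", OF _ D_eq[symmetric]])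
  qed
  have "E0 \<le> m0 * ln m0 + D 0 / \<alpha>"
  proof (rule tendsto_le[OF trivial_limit_at_right_real])
    show "((\<lambda>d. (m0 + d) * ln (m0 + d) + D d / \<alpha>) \<longlongrightarrow> m0 * ln m0 + D 0 / \<alpha>) (at_right 0)"
    proof (rule tendsto_add)
      show "((\<lambda>d. D d / \<alpha>) \<longlongrightarrow> D 0 / \<alpha>) (at_right 0)"
        using \<alpha> by (intro tendsto_divide D_lim tendsto_const) simp
      have "((\<lambda>y. y * ln y) \<longlongrightarrow> m0 * ln m0) (at m0 within {0..})"
        using x_ln_x_continuous_on m0 by (simp add: continuous_on_def)
      moreover have "filterlim (\<lambda>d. m0 + d) (at m0 within {0..}) (at_right 0)"
        unfolding filterlim_at
      proof
        show "((\<lambda>d. m0 + d) \<longlongrightarrow> m0) (at_right 0)"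
          by (rule tendsto_eq_intros | simp)+
        show "\<forall>\<^sub>F d in at_right 0. m0 + d \<in> {0..} \<and> m0 + d \<noteq> m0"
          using m0 by (auto simp: eventually_at_right_field intro!: exI[of _ 1])
      qed
      ultimately show "((\<lambda>d. (m0 + d) * ln (m0 + d)) \<longlongrightarrow> m0 * ln m0) (at_right 0)"
        by (rule filterlim_compose)
    qed
    have "((\<lambda>d::real. d * ln d) \<longlongrightarrow> 0) (at_right 0)" by real_asymp
    then have "((\<lambda>d. E0 + d * ln d) \<longlongrightarrow> E0 + 0) (at_right 0)" by (intro tendsto_intros)
    then show "((\<lambda>d. E0 + d * ln d) \<longlongrightarrow> E0) (at_right 0)" by simp
    show "\<forall>\<^sub>F d in at_right 0. E0 + d * ln d \<le> (m0 + d) * ln (m0 + d) + D d / \<alpha>"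
      using core by (auto simp: eventually_at_right_field intro!: exI[of _ 1])
  qed
  then have "E0 - m0 * ln m0 \<le> D 0 / \<alpha>" by simp
  then have "\<alpha> * (E0 - m0 * ln m0) \<le> D 0"
    using \<alpha> by (simp add: pos_le_divide_eq mult.commute)
  moreover have "D 0 = dirichlet \<Lambda> U f" by (simp add: D_def dirichlet_def)
  moreover have "Ent \<mu> (\<lambda>x. (f x)\<^sup>2) = E0 - m0 * ln m0" by (simp add: Ent_def E0_def m0_def)
  ultimately show ?thesis by simp
qed

end

section \<open>Smooth cutoffs\<close>

primrec times_differentiable :: "nat \<Rightarrow> (real \<Rightarrow> real) \<Rightarrow> bool" where
  "times_differentiable 0 f \<longleftrightarrow> True"
| "times_differentiable (Suc n) f \<longleftrightarrow>
     (\<exists>f'. (\<forall>x. (f has_real_derivative f' x) (at x)) \<and> times_differentiable n f')"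

lemma times_differentiableI:
  assumes "\<And>x. (f has_real_derivative f' x) (at x)" "times_differentiable n f'"
  shows "times_differentiable (Suc n) f"
  using assms by auto

lemma times_differentiable_SucD: "times_differentiable (Suc n) f \<Longrightarrow> times_differentiable n f"
proof (induction n arbitrary: f)
  case (Suc n)
  then obtain f' where "\<And>x. (f has_real_derivative f' x) (at x)" "times_differentiable (Suc n) f'"
    by (auto simp del: times_differentiable.simps simp: times_differentiable.simps(2)[of "Suc n"])
  then show ?case using Suc.IH by (intro times_differentiableI)
qed simp

lemma times_differentiable_add:
  "times_differentiable n f \<Longrightarrow> times_differentiable n g \<Longrightarrow> times_differentiable n (\<lambda>x. f x + g x)"
proof (induction n arbitrary: f g)
  case (Suc n)
  then obtain f' g' where d: "\<And>x. (f has_real_derivative f' x) (at x)" "times_differentiable n f'"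
    "\<And>x. (g has_real_derivative g' x) (at x)" "times_differentiable n g'" by auto
  show ?case
    by (rule times_differentiableI[where f'="\<lambda>x. f' x + g' x"])
      (auto intro!: derivative_eq_intros d Suc.IH)
qed simp

lemma times_differentiable_mult:
  "times_differentiable n f \<Longrightarrow> times_differentiable n g \<Longrightarrow> times_differentiable n (\<lambda>x. f x * g x)"
proof (induction n arbitrary: f g)
  case (Suc n)
  then obtain f' g' where d: "\<And>x. (f has_real_derivative f' x) (at x)" "times_differentiable n f'"
    "\<And>x. (g has_real_derivative g' x) (at x)" "times_differentiable n g'" by auto
  have fg: "times_differentiable n f" "times_differentiable n g"
    using Suc.prems by (auto intro: times_differentiable_SucD simp del: times_differentiable.simps)
  show ?case
    by (rule times_differentiableI[where f'="\<lambda>x. f' x * g x + f x * g' x"])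
      (auto intro!: derivative_eq_intros d Suc.IH fg times_differentiable_add)
qed simp

lemma times_differentiable_const: "times_differentiable n (\<lambda>_. c)"
  by (induction n arbitrary: c) (auto intro!: exI[of _ "\<lambda>_. 0"])

lemma times_differentiable_linear: "times_differentiable n (\<lambda>x. c * x)"
  by (cases n) (auto intro!: exI[of _ "\<lambda>_. c"] derivative_eq_intros times_differentiable_const)

text \<open>For \<open>k = 0\<close> this is the standard smooth function \<open>exp (- 1 / u)\<close> that is flat at \<open>0\<close>; the
  powers of \<open>1 / u\<close> make the family closed under differentiation up to linear combinations.\<close>

definition flat :: "nat \<Rightarrow> real \<Rightarrow> real" where
  "flat k u = (if u > 0 then exp (- (1 / u)) / u ^ k else 0)"

lemma flat_tendsto_0: "(flat k \<longlongrightarrow> 0) (at 0)"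
proof (rule filterlim_split_at)
  have "((\<lambda>u::real. (inverse u) ^ k / exp (inverse u)) \<longlongrightarrow> 0) (at_right 0)"
    by (rule filterlim_compose[OF tendsto_power_div_exp_0 filterlim_inverse_at_top_right])
  then show "(flat k \<longlongrightarrow> 0) (at_right 0)"
    by (rule Lim_transform_eventually)
      (auto simp: flat_def exp_minus field_simps eventually_at_right_field intro!: exI[of _ 1])
  show "(flat k \<longlongrightarrow> 0) (at_left 0)"
    by (rule Lim_transform_eventually[OF tendsto_const])
      (auto simp: flat_def eventually_at_left_field intro!: exI[of _ "-1"])
qed

text \<open>At the origin the difference quotient of \<open>flat k\<close> is \<open>flat (k + 1)\<close>, which tends to \<open>0\<close>.\<close>

lemma flat_DERIV: "(flat k has_real_derivative (flat (k + 2) u - k * flat (k + 1) u)) (at u)"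
proof -
  consider "u > 0" | "u < 0" | "u = 0" by linarith
  then show ?thesis
  proof cases
    case 1
    have pk: "real k * u ^ (k - Suc 0) = real k * u ^ k / u"
      using 1 by (cases k) auto
    have "((\<lambda>u. exp (- (1 / u)) / u ^ k) has_real_derivative flat (k + 2) u - k * flat (k + 1) u) (at u)"
      using 1 pk by (auto intro!: derivative_eq_intros simp: flat_def field_simps power2_eq_square)
    then show ?thesis
      by (rule has_field_derivative_transform_within_open[where S="{0<..}"]) (use 1 in \<open>auto simp: flat_def\<close>)
  next
    case 2
    have "((\<lambda>u. 0) has_real_derivative flat (k + 2) u - k * flat (k + 1) u) (at u)"
      using 2 by (simp add: flat_def)
    then show ?thesis
      by (rule has_field_derivative_transform_within_open[where S="{..<0}"]) (use 2 in \<open>auto simp: flat_def\<close>)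
  next
    case 3
    have "((\<lambda>h. (flat k (0 + h) - flat k 0) / h) \<longlongrightarrow> 0) (at 0)"
      by (rule Lim_transform_eventually[OF flat_tendsto_0[of "k + 1"]])
        (auto simp: flat_def eventually_at_filter)
    then show ?thesis using 3 by (simp add: DERIV_def flat_def)
  qed
qed

lemma times_differentiable_flat: "times_differentiable n (\<lambda>t. flat k (1 - (c * t)\<^sup>2))"
proof (induction n arbitrary: k)
  case (Suc n)
  show ?case
  proof (rule times_differentiableI[where f'="\<lambda>t. (flat (k + 2) (1 - (c * t)\<^sup>2)
        + (- real k) * flat (k + 1) (1 - (c * t)\<^sup>2)) * (- 2 * c\<^sup>2 * t)"])
    fix t
    have "((\<lambda>t. 1 - (c * t)\<^sup>2) has_real_derivative (- 2 * c\<^sup>2 * t)) (at t)"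
      by (auto intro!: derivative_eq_intros simp: power2_eq_square)
    from DERIV_chain2[OF flat_DERIV this]
    show "((\<lambda>t. flat k (1 - (c * t)\<^sup>2)) has_real_derivative (flat (k + 2) (1 - (c * t)\<^sup>2)
        + (- real k) * flat (k + 1) (1 - (c * t)\<^sup>2)) * (- 2 * c\<^sup>2 * t)) (at t)"
      by simp
  qed (intro times_differentiable_mult times_differentiable_add times_differentiable_const
        times_differentiable_linear Suc.IH)
qed simp

definition bump :: "real \<Rightarrow> real \<Rightarrow> real" where
  "bump c t = exp 1 * flat 0 (1 - (c * t)\<^sup>2)"

lemma times_differentiable_bump: "times_differentiable n (bump c)"
  unfolding bump_def by (intro times_differentiable_mult times_differentiable_const times_differentiable_flat)

lemma bump_nonneg: "bump c t \<ge> 0"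
  by (simp add: bump_def flat_def)

lemma bump_le_1: "bump c t \<le> 1"
proof (cases "1 - (c * t)\<^sup>2 > 0")
  case True
  then have "1 \<le> 1 / (1 - (c * t)\<^sup>2)" by (simp add: le_divide_eq)
  then show ?thesis using True by (simp add: bump_def flat_def mult_exp_exp)
qed (simp add: bump_def flat_def)

lemma bump_eq_0: "\<bar>c * t\<bar> \<ge> 1 \<Longrightarrow> bump c t = 0"
  using abs_le_square_iff[of 1 "c * t"] by (simp add: bump_def flat_def)

lemma bump_tendsto_1: "(\<lambda>n. bump (1 / (real n + 1)) t) \<longlonglongrightarrow> 1"
proof -
  have "(\<lambda>n. (1 / (real n + 1)) * t) \<longlonglongrightarrow> 0 * t"
    by (intro tendsto_mult tendsto_const) real_asymp
  then have "(\<lambda>n. 1 - ((1 / (real n + 1)) * t)\<^sup>2) \<longlonglongrightarrow> 1 - 0\<^sup>2"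
    by (intro tendsto_intros) simp
  moreover have "isCont (flat 0) 1" by (rule DERIV_isCont[OF flat_DERIV])
  ultimately have "(\<lambda>n. flat 0 (1 - ((1 / (real n + 1)) * t)\<^sup>2)) \<longlonglongrightarrow> flat 0 1"
    by (intro isCont_tendsto_compose[of 1 "flat 0"]) auto
  then have "(\<lambda>n. bump (1 / (real n + 1)) t) \<longlonglongrightarrow> exp 1 * flat 0 1"
    unfolding bump_def by (intro tendsto_intros)
  also have "exp 1 * flat 0 1 = 1" by (simp add: flat_def mult_exp_exp)
  finally show ?thesis .
qed

text \<open>The derivative is proportional to the scale \<open>c\<close>: by the chain rule it carries the factor \<open>c\<^sup>2 t\<close>,
  and \<open>\<bar>c t\<bar> \<le> 1\<close> on the support. This is why wide cutoffs have small gradients.\<close>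

lemma bump_DERIV:
  obtains D where "\<And>t. (bump c has_real_derivative D t) (at t)" "\<And>t. \<bar>D t\<bar> \<le> 4 * exp 1 * \<bar>c\<bar>"
proof (rule that)
  fix t
  have inner: "((\<lambda>t. 1 - (c * t)\<^sup>2) has_real_derivative (- 2 * c\<^sup>2 * t)) (at t)"
    by (auto intro!: derivative_eq_intros simp: power2_eq_square)
  show "(bump c has_real_derivative (exp 1 * (flat 2 (1 - (c * t)\<^sup>2) * (- 2 * c\<^sup>2 * t)))) (at t)"
    unfolding bump_def using DERIV_chain2[OF flat_DERIV[of 0] inner]
    by (intro DERIV_cmult) (simp add: numeral_2_eq_2)
  have flat_le: "\<bar>flat 2 u\<bar> \<le> 2" for u
  proof (cases "u > 0")
    case True
    have "1 + 1 / u + (1 / u)\<^sup>2 / 2 \<le> exp (1 / u)"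
      using True by (intro exp_lower_Taylor_quadratic) simp
    moreover have "1 / u > 0" using True by simp
    ultimately have "(1 / u)\<^sup>2 \<le> 2 * exp (1 / u)" by linarith
    then show ?thesis using True by (simp add: flat_def exp_minus field_simps)
  qed (simp add: flat_def)
  show "\<bar>exp 1 * (flat 2 (1 - (c * t)\<^sup>2) * (- 2 * c\<^sup>2 * t))\<bar> \<le> 4 * exp 1 * \<bar>c\<bar>"
  proof (cases "\<bar>c * t\<bar> < 1")
    case True
    have "\<bar>flat 2 (1 - (c * t)\<^sup>2)\<bar> * (2 * \<bar>c\<bar> * \<bar>c * t\<bar>) \<le> 2 * (2 * \<bar>c\<bar> * 1)"
      using True flat_le by (intro mult_mono) auto
    then have "exp 1 * (\<bar>flat 2 (1 - (c * t)\<^sup>2)\<bar> * (2 * \<bar>c\<bar> * \<bar>c * t\<bar>)) \<le> exp 1 * (2 * (2 * \<bar>c\<bar> * 1))"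
      by (intro mult_left_mono) auto
    moreover have "\<bar>exp 1 * (flat 2 (1 - (c * t)\<^sup>2) * (- 2 * c\<^sup>2 * t))\<bar>
        = exp 1 * (\<bar>flat 2 (1 - (c * t)\<^sup>2)\<bar> * (2 * \<bar>c\<bar> * \<bar>c * t\<bar>))"
      by (simp add: abs_mult power2_eq_square)
    ultimately show ?thesis by simp
  next
    case False
    then have "flat 2 (1 - (c * t)\<^sup>2) = 0"
      using abs_le_square_iff[of 1 "c * t"] by (simp add: flat_def)
    then show ?thesis by simp
  qed
qed

text \<open>Smoothness is the largest property that implies continuity and partial differentiability and
  that is inherited by partial derivatives.\<close>

lemma smooth_fun_coinduct:
  assumes "P f"
    and cont: "\<And>f. P f \<Longrightarrow> continuous_on (config_space \<Lambda>) f"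
    and diff: "\<And>f i x. P f \<Longrightarrow> i \<in> \<Lambda> \<Longrightarrow> x \<in> config_space \<Lambda> \<Longrightarrow> (\<lambda>t. f (x(i := t))) differentiable (at (x i))"
    and step: "\<And>f i. P f \<Longrightarrow> i \<in> \<Lambda> \<Longrightarrow> P (partial_deriv i f)"
  shows "smooth_fun \<Lambda> f"
proof -
  have "P (fold partial_deriv js f)" if "js \<in> lists \<Lambda>" for js
    using that \<open>P f\<close> by (induction js arbitrary: f) (auto intro: step)
  then show ?thesis unfolding smooth_fun_def using cont diff by blast
qed

lemma lincomb_DERIV:
  assumes f: "smooth_fun \<Lambda> f" and g: "smooth_fun \<Lambda> g" and "i \<in> \<Lambda>" "x \<in> config_space \<Lambda>"
  shows "((\<lambda>t. a * f (x(i := t)) + b * g (x(i := t))) has_real_derivative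
        (a * partial_deriv i f x + b * partial_deriv i g x)) (at (x i))"
proof -
  have "((\<lambda>t. a * f (x(i := t)) + b * g (x(i := t))) has_real_derivative
        (a * partial_deriv i f (x(i := x i)) + b * partial_deriv i g (x(i := x i)))) (at (x i))"
    using assms by (intro DERIV_add DERIV_cmult smooth_fun_DERIV)
  then show ?thesis by simp
qed

lemma smooth_fun_lincomb:
  assumes f: "smooth_fun \<Lambda> f" and g: "smooth_fun \<Lambda> g"
  shows "smooth_fun \<Lambda> (\<lambda>x. a * f x + b * g x)"
proof (rule smooth_fun_coinduct)
  let ?P = "\<lambda>h. \<exists>f g. smooth_fun \<Lambda> f \<and> smooth_fun \<Lambda> g \<and> (\<forall>x\<in>config_space \<Lambda>. h x = a * f x + b * g x)"
  show "?P (\<lambda>x. a * f x + b * g x)" using f g by blast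
  fix h assume "?P h"
  then obtain f g where fg: "smooth_fun \<Lambda> f" "smooth_fun \<Lambda> g"
    and h: "\<And>x. x \<in> config_space \<Lambda> \<Longrightarrow> h x = a * f x + b * g x" by blast
  have "continuous_on (config_space \<Lambda>) (\<lambda>x. a * f x + b * g x)"
    using fg by (intro continuous_intros smooth_fun_continuous)
  then show "continuous_on (config_space \<Lambda>) h"
    by (simp add: h cong: continuous_on_cong)
  have D: "((\<lambda>t. h (x(i := t))) has_real_derivative (a * partial_deriv i f x + b * partial_deriv i g x)) (at (x i))"
    if "i \<in> \<Lambda>" "x \<in> config_space \<Lambda>" for i x
    using lincomb_DERIV[OF fg that] that by (simp add: h config_upd)
  show "(\<lambda>t. h (x(i := t))) differentiable (at (x i))" if "i \<in> \<Lambda>" "x \<in> config_space \<Lambda>" for i x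
    using D[OF that] real_differentiable_def by blast
  show "?P (partial_deriv i h)" if "i \<in> \<Lambda>" for i
  proof (intro exI conjI ballI)
    show "smooth_fun \<Lambda> (partial_deriv i f)" "smooth_fun \<Lambda> (partial_deriv i g)"
      by (rule smooth_fun_partial_deriv[OF _ that], rule fg)+
    show "partial_deriv i h x = a * partial_deriv i f x + b * partial_deriv i g x"
      if "x \<in> config_space \<Lambda>" for x
      by (rule partial_deriv_eqI[OF D[OF \<open>i \<in> \<Lambda>\<close> that]])
  qed
qed

lemma partial_deriv_lincomb:
  assumes "smooth_fun \<Lambda> f" "smooth_fun \<Lambda> g" "i \<in> \<Lambda>" "x \<in> config_space \<Lambda>"
  shows "partial_deriv i (\<lambda>x. a * f x + b * g x) x = a * partial_deriv i f x + b * partial_deriv i g x"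
  by (rule partial_deriv_eqI) (rule lincomb_DERIV[OF assms])

lemma test_funs_lincomb:
  assumes f: "f \<in> test_funs \<Lambda>" and g: "g \<in> test_funs \<Lambda>"
  shows "(\<lambda>x. a * f x + b * g x) \<in> test_funs \<Lambda>"
proof -
  let ?S = "\<lambda>f. {x \<in> config_space \<Lambda>. f x \<noteq> 0}"
  have "closure (?S (\<lambda>x. a * f x + b * g x)) \<subseteq> closure (?S f) \<union> closure (?S g)"
    unfolding closure_Un[symmetric] by (rule closure_mono) auto
  moreover have K: "compact (closure (?S f) \<union> closure (?S g))"
    using f g by (intro compact_Un) (auto simp: test_funs_def)
  ultimately have "compact (closure (?S (\<lambda>x. a * f x + b * g x)))"
    using compact_Int_closed[OF K closed_closure, of "?S (\<lambda>x. a * f x + b * g x)"] by (simp add: inf.absorb2)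
  then show ?thesis
    using smooth_fun_lincomb[OF test_funs_smooth[OF f] test_funs_smooth[OF g]] by (simp add: test_funs_def)
qed

definition tensor :: "'i set \<Rightarrow> ('i \<Rightarrow> real \<Rightarrow> real) \<Rightarrow> ('i \<Rightarrow> real) \<Rightarrow> real" where
  "tensor \<Lambda> \<phi> x = (\<Prod>i\<in>\<Lambda>. \<phi> i (x i))"

lemma tensor_DERIV:
  assumes "finite \<Lambda>" "i \<in> \<Lambda>" "\<And>t. (\<phi> i has_real_derivative \<phi>' t) (at t)"
  shows "((\<lambda>t. tensor \<Lambda> \<phi> (x(i := t))) has_real_derivative tensor \<Lambda> (\<phi>(i := \<phi>')) x) (at (x i))"
proof -
  have split: "tensor \<Lambda> \<psi> y = \<psi> i (y i) * (\<Prod>j\<in>\<Lambda>-{i}. \<psi> j (y j))" for \<psi> :: "'a \<Rightarrow> real \<Rightarrow> real" and y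
    using assms by (simp add: tensor_def prod.remove)
  have off: "(\<Prod>j\<in>\<Lambda>-{i}. \<phi> j ((x(i := t)) j)) = (\<Prod>j\<in>\<Lambda>-{i}. \<phi> j (x j))"
    "(\<Prod>j\<in>\<Lambda>-{i}. (\<phi>(i := \<phi>')) j (x j)) = (\<Prod>j\<in>\<Lambda>-{i}. \<phi> j (x j))" for t
    by (auto intro!: prod.cong)
  show ?thesis
    unfolding split off fun_upd_same by (intro DERIV_cmult_right assms)
qed

lemma tensor_smooth:
  assumes fin: "finite \<Lambda>" and \<phi>: "\<And>i n. times_differentiable n (\<phi> i)"
  shows "smooth_fun \<Lambda> (tensor \<Lambda> \<phi>)"
proof (rule smooth_fun_coinduct)
  let ?P = "\<lambda>h. \<exists>\<phi>. (\<forall>i n. times_differentiable n (\<phi> i)) \<and> h = tensor \<Lambda> \<phi>"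
  show "?P (tensor \<Lambda> \<phi>)" using \<phi> by (intro exI[of _ \<phi>]) simp
  fix h assume "?P h"
  then obtain \<phi> where \<phi>: "\<And>i n. times_differentiable n (\<phi> i)" and h: "h = tensor \<Lambda> \<phi>" by blast
  have "\<exists>f'. (\<forall>x. (\<phi> i has_real_derivative f' x) (at x))" for i
    using \<phi>[of 1 i] by auto
  then obtain \<phi>' where \<phi>': "\<And>i x. (\<phi> i has_real_derivative \<phi>' i x) (at x)" by metis
  have td': "times_differentiable n (\<phi>' i)" for n i
  proof -
    obtain f' where f': "\<And>x. (\<phi> i has_real_derivative f' x) (at x)" "times_differentiable n f'"
      using \<phi>[of "Suc n" i] by auto
    have "f' = \<phi>' i" using DERIV_unique[OF f'(1) \<phi>'] by auto
    then show ?thesis using f' by simp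
  qed
  have "continuous_on UNIV (\<phi> i)" for i
    by (rule DERIV_continuous_on) (rule has_field_derivative_at_within[OF \<phi>'])
  then show "continuous_on (config_space \<Lambda>) h"
    unfolding h tensor_def
    by (intro continuous_on_prod continuous_on_compose2[OF _ continuous_on_subset[OF continuous_on_product_coordinates]]) auto
  show "(\<lambda>t. h (x(i := t))) differentiable (at (x i))" if "i \<in> \<Lambda>" for i x
    using tensor_DERIV[OF fin that, of \<phi>, OF \<phi>'] unfolding h real_differentiable_def by blast
  show "?P (partial_deriv i h)" if "i \<in> \<Lambda>" for i
  proof (intro exI conjI)
    show "partial_deriv i h = tensor \<Lambda> (\<phi>(i := \<phi>' i))"
      unfolding h by (intro ext partial_deriv_eqI tensor_DERIV fin that \<phi>')
    show "\<forall>j n. times_differentiable n ((\<phi>(i := \<phi>' i)) j)"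
      using \<phi> td' by simp
  qed
qed

lemma compact_config_box: "compact (\<Lambda> \<rightarrow>\<^sub>E {- R..R :: real})"
proof -
  have "(\<Lambda> \<rightarrow>\<^sub>E {- R..R}) = Pi\<^sub>E UNIV (\<lambda>i. if i \<in> \<Lambda> then {- R..R} else {undefined})"
    by (auto simp: PiE_def extensional_def Pi_def split: if_splits)
  also have "compactin (product_topology (\<lambda>i. euclidean) UNIV) \<dots>"
    unfolding compactin_PiE by auto
  finally show ?thesis by (simp add: euclidean_product_topology)
qed

lemma closed_config_box: "closed (\<Lambda> \<rightarrow>\<^sub>E {- R..R :: real})"
proof -
  have "(\<Lambda> \<rightarrow>\<^sub>E {- R..R}) = config_space \<Lambda> \<inter> (\<Inter>i\<in>\<Lambda>. {x. - R \<le> x i} \<inter> {x. x i \<le> R})"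
    by (auto simp: PiE_def)
  then show ?thesis
    by (auto intro!: closed_Int closed_INT closed_config_space closed_Collect_le)
qed

definition cutoff :: "'i set \<Rightarrow> nat \<Rightarrow> ('i \<Rightarrow> real) \<Rightarrow> real" where
  "cutoff \<Lambda> n = tensor \<Lambda> (\<lambda>_. bump (1 / (real n + 1)))"

lemma cutoff_bounds: "0 \<le> cutoff \<Lambda> n x" "cutoff \<Lambda> n x \<le> 1"
  unfolding cutoff_def tensor_def by (auto intro!: prod_nonneg prod_le_1 bump_nonneg bump_le_1)

lemma cutoff_tendsto_1: "(\<lambda>n. cutoff \<Lambda> n x) \<longlonglongrightarrow> 1"
proof -
  have "(\<lambda>n. cutoff \<Lambda> n x) \<longlonglongrightarrow> (\<Prod>i\<in>\<Lambda>. 1)"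
    unfolding cutoff_def tensor_def by (intro tendsto_prod bump_tendsto_1)
  then show ?thesis by simp
qed

lemma cutoff_test_fun:
  assumes "finite \<Lambda>"
  shows "cutoff \<Lambda> n \<in> test_funs \<Lambda>"
proof -
  let ?S = "{x \<in> config_space \<Lambda>. cutoff \<Lambda> n x \<noteq> 0}" and ?B = "\<Lambda> \<rightarrow>\<^sub>E {- (real n + 1)..real n + 1}"
  have "?S \<subseteq> ?B"
  proof
    fix x assume x: "x \<in> ?S"
    have "x i \<in> {- (real n + 1)..real n + 1}" if "i \<in> \<Lambda>" for i
    proof -
      have "bump (1 / (real n + 1)) (x i) \<noteq> 0"
        using x that assms by (auto simp: cutoff_def tensor_def)
      then have "\<bar>(1 / (real n + 1)) * x i\<bar> < 1" using bump_eq_0 not_le by blast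
      then have "\<bar>x i\<bar> < real n + 1" by (simp add: abs_mult)
      then show ?thesis by auto
    qed
    then show "x \<in> ?B" using x by (auto simp: PiE_def)
  qed
  moreover have K: "compact ?B" by (rule compact_config_box)
  ultimately have "closure ?S \<subseteq> ?B"
    by (intro closure_minimal closed_config_box)
  then have "compact (closure ?S)"
    using compact_Int_closed[OF K closed_closure, of ?S] by (simp add: inf.absorb2)
  moreover have "smooth_fun \<Lambda> (cutoff \<Lambda> n)"
    unfolding cutoff_def by (intro tensor_smooth assms times_differentiable_bump)
  ultimately show ?thesis by (simp add: test_funs_def)
qed

lemma cutoff_partial_deriv_bound:
  assumes fin: "finite \<Lambda>" and i: "i \<in> \<Lambda>"
  shows "\<bar>partial_deriv i (cutoff \<Lambda> n) x\<bar> \<le> 4 * exp 1 / (real n + 1)"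
proof -
  let ?c = "1 / (real n + 1)"
  obtain D where D: "\<And>t. (bump ?c has_real_derivative D t) (at t)" "\<And>t. \<bar>D t\<bar> \<le> 4 * exp 1 * \<bar>?c\<bar>"
    by (rule bump_DERIV) (rule that)
  have "partial_deriv i (cutoff \<Lambda> n) x = tensor \<Lambda> ((\<lambda>_. bump ?c)(i := D)) x"
    unfolding cutoff_def by (intro partial_deriv_eqI tensor_DERIV fin i D)
  also have "\<dots> = D (x i) * (\<Prod>j\<in>\<Lambda>-{i}. bump ?c (x j))"
    using fin i by (simp add: tensor_def prod.remove)
  finally have "\<bar>partial_deriv i (cutoff \<Lambda> n) x\<bar> = \<bar>D (x i)\<bar> * \<bar>\<Prod>j\<in>\<Lambda>-{i}. bump ?c (x j)\<bar>"
    by (simp add: abs_mult)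
  also have "\<dots> \<le> (4 * exp 1 * \<bar>?c\<bar>) * 1"
  proof (intro mult_mono D)
    show "\<bar>\<Prod>j\<in>\<Lambda>-{i}. bump ?c (x j)\<bar> \<le> 1"
      by (subst abs_of_nonneg) (auto intro!: prod_nonneg prod_le_1 bump_nonneg bump_le_1)
  qed auto
  finally show ?thesis by simp
qed

section \<open>From the logarithmic Sobolev inequality to the spectral gap\<close>

lemma ln_one_plus_lower_cubic:
  fixes u :: real
  assumes "\<bar>u\<bar> \<le> 1 / 2"
  shows "u - u\<^sup>2 / 2 - \<bar>u\<bar> ^ 3 \<le> ln (1 + u)"
proof (cases "u \<ge> 0")
  case True
  show ?thesis
  proof -
    define r where "r v = ln (1 + v) - v + v\<^sup>2 / 2" for v :: real
    have "r 0 \<le> r u"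
    proof (rule DERIV_nonneg_imp_nondecreasing[OF True, where f=r])
      fix v :: real assume v: "0 \<le> v" "v \<le> u"
      have "(r has_real_derivative v\<^sup>2 / (1 + v)) (at v)"
        unfolding r_def using v by (auto intro!: derivative_eq_intros simp: field_simps power2_eq_square)
      moreover have "v\<^sup>2 / (1 + v) \<ge> 0" using v by simp
      ultimately show "\<exists>y. (r has_real_derivative y) (at v) \<and> y \<ge> 0" by blast
    qed
    then have "u - u\<^sup>2 / 2 \<le> ln (1 + u)" by (simp add: r_def)
    moreover have "0 \<le> \<bar>u\<bar> ^ 3" by simp
    ultimately show ?thesis by linarith
  qed
next
  case False
  define r where "r v = ln (1 + v) - v + v\<^sup>2 / 2 - v ^ 3" for v :: real
  have "r u \<ge> r 0"
  proof (rule DERIV_nonpos_imp_nonincreasing[where f=r])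
    show "u \<le> 0" using False by simp
    fix v :: real assume v: "u \<le> v" "v \<le> 0"
    have v1: "1 + v \<ge> 1 / 2" using v assms by (auto simp: abs_le_iff)
    have "(r has_real_derivative (1 / (1 + v) - 1 + v - 3 * v\<^sup>2)) (at v)"
      unfolding r_def using v1 by (auto intro!: derivative_eq_intros)
    also have "1 / (1 + v) - 1 + v - 3 * v\<^sup>2 = v\<^sup>2 * (1 / (1 + v) - 3)"
      using v1 by (simp add: field_simps power2_eq_square)
    finally have "(r has_real_derivative v\<^sup>2 * (1 / (1 + v) - 3)) (at v)" .
    moreover have "v\<^sup>2 * (1 / (1 + v) - 3) \<le> 0"
      using v1 by (intro mult_nonneg_nonpos) (auto simp: field_simps)
    ultimately show "\<exists>y. (r has_real_derivative y) (at v) \<and> y \<le> 0" by blast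
  qed
  moreover have "\<bar>u\<bar> ^ 3 = - (u ^ 3)" using False by (simp add: abs_if)
  ultimately show ?thesis by (simp add: r_def)
qed

text \<open>The Taylor expansion of \<open>(1 + u)\<^sup>2 ln (1 + u)\<^sup>2\<close> to second order. The coefficient \<open>3\<close> exceeds by \<open>2\<close>
  the coefficient \<open>1\<close> that the second entropy term contributes, and this \<open>2\<close> cancels the one in
  front of the Dirichlet form.\<close>

lemma square_ln_square_lower_cubic:
  fixes u :: real
  assumes u: "\<bar>u\<bar> \<le> 1 / 2"
  shows "2 * u + 3 * u\<^sup>2 - 5 * \<bar>u\<bar> ^ 3 \<le> (1 + u)\<^sup>2 * ln ((1 + u)\<^sup>2)"
proof -
  have pos: "1 + u > 0" using u by linarith
  have "(1 + u)\<^sup>2 * (2 * (u - u\<^sup>2 / 2 - \<bar>u\<bar> ^ 3)) \<le> (1 + u)\<^sup>2 * (2 * ln (1 + u))"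
    using ln_one_plus_lower_cubic[OF u] by (intro mult_left_mono) auto
  also have "2 * ln (1 + u) = ln ((1 + u)\<^sup>2)" using pos by (simp add: ln_realpow)
  finally have 1: "(1 + u)\<^sup>2 * (2 * (u - u\<^sup>2 / 2 - \<bar>u\<bar> ^ 3)) \<le> (1 + u)\<^sup>2 * ln ((1 + u)\<^sup>2)" .
  have "(1 + u)\<^sup>2 * (2 * (u - u\<^sup>2 / 2 - \<bar>u\<bar> ^ 3)) = 2 * u + 3 * u\<^sup>2 - (u\<^sup>2)\<^sup>2 - 2 * ((1 + u)\<^sup>2 * \<bar>u\<bar> ^ 3)"
    by (simp add: field_simps power2_eq_square)
  moreover have "(1 + u)\<^sup>2 * \<bar>u\<bar> ^ 3 \<le> (9 / 4) * \<bar>u\<bar> ^ 3"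
  proof (intro mult_right_mono)
    have "(1 + u)\<^sup>2 \<le> (3 / 2)\<^sup>2" using u pos by (intro power_mono) linarith+
    then show "(1 + u)\<^sup>2 \<le> 9 / 4" by (simp add: power_divide)
  qed simp
  moreover have "(u\<^sup>2)\<^sup>2 \<le> (1 / 2) * \<bar>u\<bar> ^ 3"
  proof -
    have "(w\<^sup>2)\<^sup>2 = w * w ^ 3" for w :: real
      by (simp add: power2_eq_square power3_eq_cube)
    from this[of "\<bar>u\<bar>"] have "(u\<^sup>2)\<^sup>2 = \<bar>u\<bar> * \<bar>u\<bar> ^ 3" by (simp only: power2_abs)
    also have "\<dots> \<le> (1 / 2) * \<bar>u\<bar> ^ 3" using u by (intro mult_right_mono) auto
    finally show ?thesis .
  qed
  ultimately show ?thesis using 1 by linarith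
qed

context gibbs_potential
begin

lemma bounded_convergence_comp:
  fixes g :: "nat \<Rightarrow> ('i \<Rightarrow> real) \<Rightarrow> real" and \<phi> :: "real \<Rightarrow> real"
  assumes \<phi>: "continuous_on UNIV \<phi>"
    and meas: "\<And>n. g n \<in> borel_measurable (config_lborel \<Lambda>)"
    and bound: "\<And>n x. x \<in> config_space \<Lambda> \<Longrightarrow> \<bar>g n x\<bar> \<le> B"
    and lim: "\<And>x. x \<in> config_space \<Lambda> \<Longrightarrow> (\<lambda>n. g n x) \<longlonglongrightarrow> h x"
  shows "(\<lambda>n. \<integral>x. \<phi> (g n x) \<partial>\<mu>) \<longlonglongrightarrow> (\<integral>x. \<phi> (h x) \<partial>\<mu>)"
proof -
  obtain C where C: "\<And>y. \<bar>y\<bar> \<le> B \<Longrightarrow> \<bar>\<phi> y\<bar> \<le> C"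
    by (rule continuous_bounded_on_interval[OF \<phi>, of B]) (rule that)
  have \<phi>m: "\<phi> \<in> borel_measurable borel" by (rule borel_measurable_continuous_onI[OF \<phi>])
  have gm: "g n \<in> borel_measurable \<mu>" for n
    using meas[of n] by (simp add: measurable_cong_sets[OF sets_gibbs refl])
  have hm: "h \<in> borel_measurable \<mu>"
    by (rule borel_measurable_LIMSEQ_real[of _ g]) (simp_all add: lim gm)
  show ?thesis
  proof (rule integral_dominated_convergence[where w="\<lambda>_. C"])
    show "(\<lambda>x. \<phi> (h x)) \<in> borel_measurable \<mu>" by (rule measurable_compose[OF hm \<phi>m])
    show "(\<lambda>x. \<phi> (g n x)) \<in> borel_measurable \<mu>" for n by (rule measurable_compose[OF gm \<phi>m])
    show "AE x in \<mu>. (\<lambda>n. \<phi> (g n x)) \<longlonglongrightarrow> \<phi> (h x)"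
      using lim \<phi> by (intro AE_I2 continuous_on_tendsto_compose[OF \<phi>]) auto
    show "AE x in \<mu>. norm (\<phi> (g n x)) \<le> C" for n
    proof (rule AE_I2)
      fix x assume "x \<in> space \<mu>"
      then have "\<bar>g n x\<bar> \<le> B" by (intro bound) simp
      then show "norm (\<phi> (g n x)) \<le> C" unfolding real_norm_def by (rule C)
    qed
  qed simp
qed

text \<open>Linearisation at the constant function \<open>1\<close>: for the centred function \<open>f0\<close>, the entropy of
  \<open>(1 + e f0)\<^sup>2\<close> is \<open>2 e\<^sup>2 Var f\<close> up to higher order, while the Dirichlet form of \<open>1 + e f0\<close> is \<open>e\<^sup>2\<close> times
  that of \<open>f\<close>. Since \<open>1 + e f0\<close> has no compact support, its constant part is first multiplied by a
  cutoff, which is removed by dominated convergence. For \<open>\<sigma> \<le> 0\<close> the claim is trivial.\<close>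

theorem log_sobolev_imp_poincare:
  assumes lsi: "\<And>g. g \<in> test_funs \<Lambda> \<Longrightarrow> \<sigma> * Ent \<mu> (\<lambda>x. (g x)\<^sup>2) \<le> 2 * dirichlet \<Lambda> U g"
    and f: "f \<in> test_funs \<Lambda>"
  shows "\<sigma> * variance f \<le> dirichlet \<Lambda> U f"
proof (cases "\<sigma> > 0")
  case False
  have "\<sigma> * variance f \<le> 0"
    using False by (intro mult_nonpos_nonneg integral_nonneg_AE) auto
  also have "0 \<le> dirichlet \<Lambda> U f"
    unfolding dirichlet_def by (intro integral_nonneg_AE AE_I2 sum_nonneg) auto
  finally show ?thesis .
next
  case \<sigma>: True
  define m where "m = expectation f"
  define f0 where "f0 = (\<lambda>x. f x - m)"
  define V where "V = expectation (\<lambda>x. (f0 x)\<^sup>2)"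
  have V: "V = variance f" by (simp add: V_def f0_def m_def)
  have V0: "V \<ge> 0" unfolding V_def by (intro integral_nonneg_AE) auto
  obtain B where B: "B > 0" "\<And>x. x \<in> config_space \<Lambda> \<Longrightarrow> \<bar>f x\<bar> \<le> B"
    using test_funs_bounded[OF f] by blast
  have int_\<phi>: "integrable \<mu> (\<lambda>x. \<phi> (f0 x))" if "continuous_on UNIV \<phi>" for \<phi> :: "real \<Rightarrow> real"
    unfolding f0_def
    by (rule test_funs_integrable_comp[OF f, of "\<lambda>y. \<phi> (y - m)"])
      (intro continuous_on_compose2[OF that] continuous_intros, simp)
  have int_f0: "integrable \<mu> f0" by (rule int_\<phi>[of "\<lambda>y. y"]) (rule continuous_on_id)
  have int_f0_2: "integrable \<mu> (\<lambda>x. (f0 x)\<^sup>2)" by (rule int_\<phi>) (intro continuous_intros)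
  have "integrable \<mu> f" by (rule test_funs_integrable_comp[OF f, of "\<lambda>y. y"]) (rule continuous_on_id)
  then have f0_mean: "expectation f0 = 0"
    unfolding f0_def by (simp add: m_def prob_space[unfolded space_gibbs])
  define C where "C = B + \<bar>m\<bar>"
  have C: "C > 0" "\<And>x. x \<in> config_space \<Lambda> \<Longrightarrow> \<bar>f0 x\<bar> \<le> C"
    using B by (auto simp: C_def f0_def intro: order_trans[OF abs_triangle_ineq4])
  have cont_sq: "continuous_on UNIV (\<lambda>y::real. y\<^sup>2)" by (intro continuous_intros)
  have cont_xlnx: "continuous_on UNIV (\<lambda>y::real. y\<^sup>2 * ln (y\<^sup>2))"
    by (rule continuous_on_compose2[OF x_ln_x_continuous_on, where f="\<lambda>y. y\<^sup>2"])
      (auto intro!: continuous_intros)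
  have step1: "\<sigma> * Ent \<mu> (\<lambda>x. (1 + e * f0 x)\<^sup>2) \<le> 2 * (e\<^sup>2 * dirichlet \<Lambda> U f)" for e :: real
  proof -
    define a where "a = 1 - e * m"
    \<comment> \<open>As the cutoff tends to \<open>1\<close>, this tends to \<open>a + e f = 1 + e f0\<close>.\<close>
    define g where "g n = (\<lambda>x. a * cutoff \<Lambda> n x + e * f x)" for n
    have g: "g n \<in> test_funs \<Lambda>" for n
      unfolding g_def by (intro test_funs_lincomb cutoff_test_fun fin f)
    have g_lim: "(\<lambda>n. g n x) \<longlonglongrightarrow> 1 + e * f0 x" for x
    proof -
      have "(\<lambda>n. g n x) \<longlonglongrightarrow> a * 1 + e * f x"
        unfolding g_def by (intro tendsto_intros cutoff_tendsto_1)
      then show ?thesis by (simp add: a_def f0_def algebra_simps)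
    qed
    have g_bound: "\<bar>g n x\<bar> \<le> \<bar>a\<bar> + \<bar>e\<bar> * B" if "x \<in> config_space \<Lambda>" for n x
    proof -
      have "\<bar>g n x\<bar> \<le> \<bar>a * cutoff \<Lambda> n x\<bar> + \<bar>e * f x\<bar>" unfolding g_def by (rule abs_triangle_ineq)
      also have "\<dots> \<le> \<bar>a\<bar> * 1 + \<bar>e\<bar> * B"
        unfolding abs_mult using cutoff_bounds[of \<Lambda> n x] B(2)[OF that]
        by (intro add_mono mult_left_mono) auto
      finally show ?thesis by simp
    qed
    note lim = bounded_convergence_comp[OF _ test_funs_measurable[OF g] g_bound g_lim]
    have sq_lim: "(\<lambda>n. expectation (\<lambda>x. (g n x)\<^sup>2)) \<longlonglongrightarrow> expectation (\<lambda>x. (1 + e * f0 x)\<^sup>2)"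
      by (rule lim[OF cont_sq])
    have Ent_lim: "(\<lambda>n. Ent \<mu> (\<lambda>x. (g n x)\<^sup>2)) \<longlonglongrightarrow> Ent \<mu> (\<lambda>x. (1 + e * f0 x)\<^sup>2)"
      unfolding Ent_def
    proof (intro tendsto_diff lim[OF cont_xlnx])
      show "(\<lambda>n. expectation (\<lambda>x. (g n x)\<^sup>2) * ln (expectation (\<lambda>x. (g n x)\<^sup>2)))
          \<longlonglongrightarrow> expectation (\<lambda>x. (1 + e * f0 x)\<^sup>2) * ln (expectation (\<lambda>x. (1 + e * f0 x)\<^sup>2))"
        by (rule continuous_on_tendsto_compose[OF x_ln_x_continuous_on sq_lim])
          (auto intro!: integral_nonneg_AE always_eventually)
    qed
    have D_lim: "(\<lambda>n. dirichlet \<Lambda> U (g n)) \<longlonglongrightarrow> e\<^sup>2 * dirichlet \<Lambda> U f"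
    proof -
      have pg: "partial_deriv i (g n) x = a * partial_deriv i (cutoff \<Lambda> n) x + e * partial_deriv i f x"
        if "i \<in> \<Lambda>" "x \<in> config_space \<Lambda>" for i n x
        unfolding g_def
        by (rule partial_deriv_lincomb[OF test_funs_smooth[OF cutoff_test_fun[OF fin]] test_funs_smooth[OF f] that])
      have one: "(\<lambda>n. expectation (\<lambda>x. (partial_deriv i (g n) x)\<^sup>2))
          \<longlonglongrightarrow> expectation (\<lambda>x. (e * partial_deriv i f x)\<^sup>2)" if i: "i \<in> \<Lambda>" for i
      proof -
        obtain B' where B': "\<And>x. x \<in> config_space \<Lambda> \<Longrightarrow> \<bar>partial_deriv i f x\<bar> \<le> B'"
          using test_funs_bounded[OF test_funs_partial_deriv[OF f i]] by blast
        show ?thesis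
        proof (rule bounded_convergence_comp[OF cont_sq])
          show "partial_deriv i (g n) \<in> borel_measurable (config_lborel \<Lambda>)" for n
            by (intro test_funs_measurable test_funs_partial_deriv g i)
          fix x assume x: "x \<in> config_space \<Lambda>"
          have small: "\<bar>partial_deriv i (cutoff \<Lambda> n) x\<bar> \<le> 4 * exp 1 / (real n + 1)" for n
            by (rule cutoff_partial_deriv_bound[OF fin i])
          have "(\<lambda>n. 4 * exp 1 / (real n + 1)) \<longlonglongrightarrow> 0" by real_asymp
          then have "(\<lambda>n. partial_deriv i (cutoff \<Lambda> n) x) \<longlonglongrightarrow> 0"
            by (rule Lim_null_comparison[rotated]) (simp add: small)
          then have "(\<lambda>n. a * partial_deriv i (cutoff \<Lambda> n) x + e * partial_deriv i f x)
              \<longlonglongrightarrow> a * 0 + e * partial_deriv i f x"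
            by (intro tendsto_intros)
          then show "(\<lambda>n. partial_deriv i (g n) x) \<longlonglongrightarrow> e * partial_deriv i f x"
            by (simp add: pg[OF i x])
          fix n
          have "\<bar>partial_deriv i (g n) x\<bar> \<le> \<bar>a * partial_deriv i (cutoff \<Lambda> n) x\<bar> + \<bar>e * partial_deriv i f x\<bar>"
            unfolding pg[OF i x] by (rule abs_triangle_ineq)
          also have "\<dots> \<le> \<bar>a\<bar> * (4 * exp 1) + \<bar>e\<bar> * B'"
          proof -
            have "\<bar>partial_deriv i (cutoff \<Lambda> n) x\<bar> \<le> 4 * exp 1"
              by (rule order_trans[OF small]) (simp add: divide_le_eq)
            then show ?thesis unfolding abs_mult using B'[OF x] by (intro add_mono mult_left_mono) auto
          qed
          finally show "\<bar>partial_deriv i (g n) x\<bar> \<le> \<bar>a\<bar> * (4 * exp 1) + \<bar>e\<bar> * B'" .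
        qed
      qed
      have D_sum: "dirichlet \<Lambda> U h = (\<Sum>i\<in>\<Lambda>. expectation (\<lambda>x. (partial_deriv i h x)\<^sup>2))"
        if h: "h \<in> test_funs \<Lambda>" for h
        unfolding dirichlet_def
        by (intro Bochner_Integration.integral_sum
            test_funs_integrable_comp[OF test_funs_partial_deriv[OF h] cont_sq])
      have "(\<lambda>n. \<Sum>i\<in>\<Lambda>. expectation (\<lambda>x. (partial_deriv i (g n) x)\<^sup>2))
          \<longlonglongrightarrow> (\<Sum>i\<in>\<Lambda>. expectation (\<lambda>x. (e * partial_deriv i f x)\<^sup>2))"
        by (intro tendsto_sum one)
      moreover have "(\<Sum>i\<in>\<Lambda>. expectation (\<lambda>x. (e * partial_deriv i f x)\<^sup>2)) = e\<^sup>2 * dirichlet \<Lambda> U f"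
        by (simp add: D_sum[OF f] power_mult_distrib sum_distrib_left)
      ultimately show ?thesis by (simp add: D_sum[OF g])
    qed
    have "(\<lambda>n. \<sigma> * Ent \<mu> (\<lambda>x. (g n x)\<^sup>2)) \<longlonglongrightarrow> \<sigma> * Ent \<mu> (\<lambda>x. (1 + e * f0 x)\<^sup>2)"
      by (intro tendsto_intros Ent_lim)
    moreover have "(\<lambda>n. 2 * dirichlet \<Lambda> U (g n)) \<longlonglongrightarrow> 2 * (e\<^sup>2 * dirichlet \<Lambda> U f)"
      by (intro tendsto_intros D_lim)
    ultimately show ?thesis
      by (rule LIMSEQ_le) (use lsi[OF g] in auto)
  qed
  have step2: "e\<^sup>2 * (2 * V - 5 * e * C * V - e\<^sup>2 * V\<^sup>2) \<le> Ent \<mu> (\<lambda>x. (1 + e * f0 x)\<^sup>2)"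
    if e: "0 < e" "e * C \<le> 1 / 2" for e
  proof -
    define M where "M = expectation (\<lambda>x. (1 + e * f0 x)\<^sup>2)"
    have "M = expectation (\<lambda>x. 1 + 2 * e * f0 x + e\<^sup>2 * (f0 x)\<^sup>2)"
      unfolding M_def by (intro Bochner_Integration.integral_cong refl)
        (simp add: power2_sum power_mult_distrib)
    also have "\<dots> = 1 + e\<^sup>2 * V"
      using int_f0 int_f0_2 by (simp add: prob_space[unfolded space_gibbs] f0_mean V_def)
    finally have M: "M = 1 + e\<^sup>2 * V" .
    have M1: "M \<ge> 1" using V0 M by simp
    have "M * ln M \<le> M * (M - 1)"
      using M1 ln_le_minus_one[of M] by (intro mult_left_mono) auto
    also have "\<dots> = e\<^sup>2 * V + (e\<^sup>2)\<^sup>2 * V\<^sup>2" by (simp add: M algebra_simps power2_eq_square)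
    finally have up: "M * ln M \<le> e\<^sup>2 * V + (e\<^sup>2)\<^sup>2 * V\<^sup>2" .
    have "(3 * e\<^sup>2 - 5 * (e * C) * e\<^sup>2) * V
        = expectation (\<lambda>x. 2 * e * f0 x + (3 * e\<^sup>2 - 5 * (e * C) * e\<^sup>2) * (f0 x)\<^sup>2)"
      using int_f0 int_f0_2 by (simp add: f0_mean V_def)
    also have "\<dots> \<le> expectation (\<lambda>x. (1 + e * f0 x)\<^sup>2 * ln ((1 + e * f0 x)\<^sup>2))"
    proof (rule integral_mono_config)
      show "integrable \<mu> (\<lambda>x. 2 * e * f0 x + (3 * e\<^sup>2 - 5 * (e * C) * e\<^sup>2) * (f0 x)\<^sup>2)"
        using int_f0 int_f0_2 by simp
      show "integrable \<mu> (\<lambda>x. (1 + e * f0 x)\<^sup>2 * ln ((1 + e * f0 x)\<^sup>2))"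
        by (rule int_\<phi>[of "\<lambda>y. (1 + e * y)\<^sup>2 * ln ((1 + e * y)\<^sup>2)"])
          (rule continuous_on_compose2[OF cont_xlnx], auto intro!: continuous_intros)
      fix x assume x: "x \<in> config_space \<Lambda>"
      have small: "\<bar>e * f0 x\<bar> \<le> e * C" using e C(2)[OF x] by (simp add: abs_mult)
      have "\<bar>e * f0 x\<bar> ^ 3 = \<bar>e * f0 x\<bar> * (e\<^sup>2 * (f0 x)\<^sup>2)"
        by (simp add: power3_eq_cube power2_eq_square abs_mult mult_ac)
      also have "\<dots> \<le> (e * C) * (e\<^sup>2 * (f0 x)\<^sup>2)"
        using small by (intro mult_right_mono) auto
      finally have "2 * e * f0 x + (3 * e\<^sup>2 - 5 * (e * C) * e\<^sup>2) * (f0 x)\<^sup>2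
          \<le> 2 * (e * f0 x) + 3 * (e * f0 x)\<^sup>2 - 5 * \<bar>e * f0 x\<bar> ^ 3"
        by (simp add: power_mult_distrib left_diff_distrib)
      also have "\<dots> \<le> (1 + e * f0 x)\<^sup>2 * ln ((1 + e * f0 x)\<^sup>2)"
        using small e by (intro square_ln_square_lower_cubic) auto
      finally show "2 * e * f0 x + (3 * e\<^sup>2 - 5 * (e * C) * e\<^sup>2) * (f0 x)\<^sup>2
          \<le> (1 + e * f0 x)\<^sup>2 * ln ((1 + e * f0 x)\<^sup>2)" .
    qed
    finally have "(3 * e\<^sup>2 - 5 * (e * C) * e\<^sup>2) * V - (e\<^sup>2 * V + (e\<^sup>2)\<^sup>2 * V\<^sup>2)
        \<le> Ent \<mu> (\<lambda>x. (1 + e * f0 x)\<^sup>2)"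
      using up unfolding Ent_def M_def[symmetric] by linarith
    then show ?thesis by (simp add: algebra_simps power2_eq_square)
  qed
  have step3: "\<sigma> * (2 * V - 5 * e * C * V - e\<^sup>2 * V\<^sup>2) \<le> 2 * dirichlet \<Lambda> U f"
    if e: "0 < e" "e * C \<le> 1 / 2" for e
  proof -
    have "e\<^sup>2 * (\<sigma> * (2 * V - 5 * e * C * V - e\<^sup>2 * V\<^sup>2))
        = \<sigma> * (e\<^sup>2 * (2 * V - 5 * e * C * V - e\<^sup>2 * V\<^sup>2))" by (simp only: mult_ac)
    also have "\<dots> \<le> \<sigma> * Ent \<mu> (\<lambda>x. (1 + e * f0 x)\<^sup>2)"
      using \<sigma> step2[OF e] by (intro mult_left_mono) auto
    also have "\<dots> \<le> 2 * (e\<^sup>2 * dirichlet \<Lambda> U f)" by (rule step1)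
    finally have "e\<^sup>2 * (\<sigma> * (2 * V - 5 * e * C * V - e\<^sup>2 * V\<^sup>2)) \<le> e\<^sup>2 * (2 * dirichlet \<Lambda> U f)"
      by (simp only: mult_ac)
    then show ?thesis using e by simp
  qed
  have "\<sigma> * (2 * V) \<le> 2 * dirichlet \<Lambda> U f"
  proof (rule tendsto_upperbound[OF _ _ trivial_limit_at_right_real])
    have "((\<lambda>e. \<sigma> * (2 * V - 5 * e * C * V - e\<^sup>2 * V\<^sup>2)) \<longlongrightarrow> \<sigma> * (2 * V - 5 * 0 * C * V - 0\<^sup>2 * V\<^sup>2)) (at_right 0)"
      by (intro tendsto_intros)
    then show "((\<lambda>e. \<sigma> * (2 * V - 5 * e * C * V - e\<^sup>2 * V\<^sup>2)) \<longlongrightarrow> \<sigma> * (2 * V)) (at_right 0)" by simp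
    show "\<forall>\<^sub>F e in at_right 0. \<sigma> * (2 * V - 5 * e * C * V - e\<^sup>2 * V\<^sup>2) \<le> 2 * dirichlet \<Lambda> U f"
      unfolding eventually_at_right_field
    proof (intro exI[of _ "1 / (2 * C)"] conjI allI impI)
      fix e :: real assume "0 < e" "e < 1 / (2 * C)"
      then show "\<sigma> * (2 * V - 5 * e * C * V - e\<^sup>2 * V\<^sup>2) \<le> 2 * dirichlet \<Lambda> U f"
        using C by (intro step3) (auto simp: field_simps)
    qed (use C in simp)
  qed
  then show ?thesis by (simp add: V)
qed

end

section \<open>The lattice potential\<close>

lemma square_convex_combination:
  fixes a b s t :: real
  assumes "t + s = 1"
  shows "t * a\<^sup>2 + s * b\<^sup>2 - (t * a + s * b)\<^sup>2 = t * s * (a - b)\<^sup>2"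
proof -
  have t: "t = 1 - s" using assms by simp
  show ?thesis unfolding t by (simp add: power2_eq_square algebra_simps)
qed

lemma square_convex:
  fixes a b s t :: real
  assumes "t + s = 1" "0 < t" "0 < s"
  shows "(t * a + s * b)\<^sup>2 \<le> t * a\<^sup>2 + s * b\<^sup>2"
proof -
  have "0 \<le> t * s * (a - b)\<^sup>2" using assms by simp
  then show ?thesis using square_convex_combination[OF assms(1), of a b] by linarith
qed

text \<open>The single-site term has convexity defect exactly \<open>\<alpha> t s \<bar>x - y\<bar>\<^sup>2\<close>. The interaction terms are
  squares of affine functions of the configuration, for every boundary condition, so they only
  improve the bound; this makes the constant uniform in the volume and the boundary condition.\<close>

lemma potential_uniformly_convex:
  fixes \<Lambda> :: "(int ^ 'd) set"
  assumes J: "J \<ge> 0" and ts: "0 < t" "0 < s" "t + s = 1"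
  shows "\<alpha> * t * s * (\<Sum>i\<in>\<Lambda>. (x i - y i)\<^sup>2)
    \<le> t * potential (\<lambda>v. \<alpha> * v\<^sup>2) J \<Lambda> \<omega> x + s * potential (\<lambda>v. \<alpha> * v\<^sup>2) J \<Lambda> \<omega> y
      - potential (\<lambda>v. \<alpha> * v\<^sup>2) J \<Lambda> \<omega> (\<lambda>i\<in>\<Lambda>. t * x i + s * y i)"
proof -
  define z where "z = (\<lambda>i\<in>\<Lambda>. t * x i + s * y i)"
  define P where "P x = (\<Sum>i\<in>\<Lambda>. (x i)\<^sup>2)" for x :: "int ^ 'd \<Rightarrow> real"
  define Q where "Q x = (\<Sum>i\<in>\<Lambda>. \<Sum>j \<in> neighbours i \<inter> \<Lambda>. (x i - x j)\<^sup>2)" for x :: "int ^ 'd \<Rightarrow> real"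
  define R where "R x = (\<Sum>i\<in>\<Lambda>. \<Sum>j \<in> neighbours i - \<Lambda>. (x i - \<omega> j)\<^sup>2)" for x :: "int ^ 'd \<Rightarrow> real"
  have pot: "potential (\<lambda>v. \<alpha> * v\<^sup>2) J \<Lambda> \<omega> x = \<alpha> * P x + J * (1/2 * Q x + R x)" for x
    by (simp add: potential_def P_def Q_def R_def sum_distrib_left distrib_left)
  have s: "s = 1 - t" using ts by simp
  have PP: "t * P x + s * P y - P z = t * s * (\<Sum>i\<in>\<Lambda>. (x i - y i)\<^sup>2)"
  proof -
    have "t * P x + s * P y - P z = (\<Sum>i\<in>\<Lambda>. t * (x i)\<^sup>2 + s * (y i)\<^sup>2 - (z i)\<^sup>2)"
      by (simp add: P_def sum_distrib_left sum.distrib sum_subtractf)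
    also have "\<dots> = (\<Sum>i\<in>\<Lambda>. t * s * (x i - y i)\<^sup>2)"
      by (intro sum.cong refl) (simp add: z_def square_convex_combination[OF ts(3)])
    finally show ?thesis by (simp add: sum_distrib_left)
  qed
  have QQ: "Q z \<le> t * Q x + s * Q y"
  proof -
    have "Q z \<le> (\<Sum>i\<in>\<Lambda>. \<Sum>j \<in> neighbours i \<inter> \<Lambda>. t * (x i - x j)\<^sup>2 + s * (y i - y j)\<^sup>2)"
      unfolding Q_def
    proof (intro sum_mono)
      fix i j assume "i \<in> \<Lambda>" "j \<in> neighbours i \<inter> \<Lambda>"
      then have "z i - z j = t * (x i - x j) + s * (y i - y j)" by (simp add: z_def algebra_simps)
      then show "(z i - z j)\<^sup>2 \<le> t * (x i - x j)\<^sup>2 + s * (y i - y j)\<^sup>2"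
        using square_convex[OF ts(3,1,2)] by simp
    qed
    then show ?thesis by (simp add: Q_def sum_distrib_left sum.distrib)
  qed
  have RR: "R z \<le> t * R x + s * R y"
  proof -
    have "R z \<le> (\<Sum>i\<in>\<Lambda>. \<Sum>j \<in> neighbours i - \<Lambda>. t * (x i - \<omega> j)\<^sup>2 + s * (y i - \<omega> j)\<^sup>2)"
      unfolding R_def
    proof (intro sum_mono)
      fix i j assume "i \<in> \<Lambda>" "j \<in> neighbours i - \<Lambda>"
      then have "z i - \<omega> j = t * (x i - \<omega> j) + s * (y i - \<omega> j)" by (simp add: z_def s algebra_simps)
      then show "(z i - \<omega> j)\<^sup>2 \<le> t * (x i - \<omega> j)\<^sup>2 + s * (y i - \<omega> j)\<^sup>2"
        using square_convex[OF ts(3,1,2)] by simp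
    qed
    then show ?thesis by (simp add: R_def sum_distrib_left sum.distrib)
  qed
  have "0 \<le> J * (1/2 * (t * Q x + s * Q y - Q z) + (t * R x + s * R y - R z))"
    using J QQ RR by simp
  moreover have "t * (\<alpha> * P x + J * (1/2 * Q x + R x)) + s * (\<alpha> * P y + J * (1/2 * Q y + R y))
      - (\<alpha> * P z + J * (1/2 * Q z + R z))
    = \<alpha> * (t * P x + s * P y - P z)
      + J * (1/2 * (t * Q x + s * Q y - Q z) + (t * R x + s * R y - R z))"
    by (simp add: algebra_simps)
  ultimately show ?thesis
    unfolding pot z_def[symmetric] PP by (simp add: mult.assoc)
qed

lemma nn_integral_gaussian_finite:
  fixes \<alpha> :: real
  assumes "\<alpha> > 0"
  shows "(\<integral>\<^sup>+x. ennreal (exp (- (\<alpha> * x\<^sup>2))) \<partial>lborel) < \<infinity>"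
proof -
  define r where "r = sqrt (1 / (2 * \<alpha>))"
  have r: "r > 0" "r\<^sup>2 = 1 / (2 * \<alpha>)" using assms by (auto simp: r_def)
  have "integrable lborel (\<lambda>x. sqrt (2 * pi * r\<^sup>2) * normal_density 0 r x)"
    using r by simp
  moreover have "sqrt (2 * pi * r\<^sup>2) * normal_density 0 r x = exp (- (\<alpha> * x\<^sup>2))" for x
    using r assms by (simp add: normal_density_def)
  ultimately have "integrable lborel (\<lambda>x. exp (- (\<alpha> * x\<^sup>2)))" by simp
  then show ?thesis by (simp add: integrable_iff_bounded)
qed

text \<open>The interaction is nonnegative, so the Gibbs weight is dominated by a product of
  one-dimensional Gaussians; and a positive function on a space of positive measure has positive
  integral.\<close>

lemma gibbs_potential_quadratic:
  fixes \<Lambda> :: "(int ^ 'd) set"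
  assumes J: "J \<ge> 0" and \<alpha>: "\<alpha> > 0" and fin: "finite \<Lambda>"
  shows "gibbs_potential \<Lambda> (potential (\<lambda>v. \<alpha> * v\<^sup>2) J \<Lambda> \<omega>)"
proof
  interpret product_sigma_finite "\<lambda>_. lborel :: real measure" by (rule product_sigma_finite_lborel)
  let ?U = "potential (\<lambda>v. \<alpha> * v\<^sup>2) J \<Lambda> \<omega>"
  show "finite \<Lambda>" by (rule fin)
  show meas [measurable]: "?U \<in> borel_measurable (config_lborel \<Lambda>)"
    unfolding potential_def by measurable
  have lower: "\<alpha> * (\<Sum>i\<in>\<Lambda>. (x i)\<^sup>2) \<le> ?U x" for x
    using J by (simp add: potential_def sum_distrib_left sum_nonneg)
  have "partition_fun \<Lambda> ?U \<le> (\<integral>\<^sup>+x. (\<Prod>i\<in>\<Lambda>. ennreal (exp (- (\<alpha> * (x i)\<^sup>2)))) \<partial>config_lborel \<Lambda>)"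
    unfolding partition_fun_def
  proof (intro nn_integral_mono)
    fix x :: "int ^ 'd \<Rightarrow> real"
    have "(\<Prod>i\<in>\<Lambda>. ennreal (exp (- (\<alpha> * (x i)\<^sup>2)))) = ennreal (exp (- (\<alpha> * (\<Sum>i\<in>\<Lambda>. (x i)\<^sup>2))))"
      using fin by (simp add: prod_ennreal exp_sum[symmetric] sum_negf sum_distrib_left)
    then show "ennreal (exp (- ?U x)) \<le> (\<Prod>i\<in>\<Lambda>. ennreal (exp (- (\<alpha> * (x i)\<^sup>2))))"
      using lower[of x] by (simp add: ennreal_leI)
  qed
  also have "\<dots> = (\<Prod>i\<in>\<Lambda>. (\<integral>\<^sup>+x. ennreal (exp (- (\<alpha> * x\<^sup>2))) \<partial>lborel))"
    by (rule product_nn_integral_prod[OF fin]) measurable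
  also have "\<dots> < \<infinity>"
    using nn_integral_gaussian_finite[OF \<alpha>] by (simp add: power_less_top_ennreal)
  finally show "partition_fun \<Lambda> ?U < \<infinity>" .
  show "0 < partition_fun \<Lambda> ?U"
  proof (rule ccontr)
    assume "\<not> 0 < partition_fun \<Lambda> ?U"
    then have "(\<integral>\<^sup>+x. ennreal (exp (- ?U x)) \<partial>config_lborel \<Lambda>) = 0"
      by (simp add: partition_fun_def)
    then have "AE x in config_lborel \<Lambda>. ennreal (exp (- ?U x)) = 0"
      by (subst (asm) nn_integral_0_iff_AE) measurable
    then have "AE x in config_lborel \<Lambda>. False" by simp
    then have "emeasure (config_lborel \<Lambda>) (space (config_lborel \<Lambda>)) = 0"
      by (simp add: trivial_limit_def[symmetric] ae_filter_eq_bot_iff)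
    moreover have "emeasure (config_lborel \<Lambda>) (\<Lambda> \<rightarrow>\<^sub>E {0..1}) = 1"
      using fin by (subst emeasure_PiM) auto
    moreover have "emeasure (config_lborel \<Lambda>) (\<Lambda> \<rightarrow>\<^sub>E {0..1}) \<le> emeasure (config_lborel \<Lambda>) (space (config_lborel \<Lambda>))"
      by (rule emeasure_space)
    ultimately show False by simp
  qed
qed

theorem theorem6p2:
  fixes J \<alpha> :: real
  assumes "J \<ge> 0" and "\<alpha> > 0"
  shows "(INF \<Lambda> \<in> {\<Lambda> :: (int ^ 'd) set. finite \<Lambda> \<and> \<Lambda> \<noteq> {}}. INF \<omega>.
            spectral_gap \<Lambda> (potential (\<lambda>t. \<alpha> * t\<^sup>2) J \<Lambda> \<omega>))
         \<ge> (INF \<Lambda> \<in> {\<Lambda> :: (int ^ 'd) set. finite \<Lambda> \<and> \<Lambda> \<noteq> {}}. INF \<omega>.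
            log_sobolev_const \<Lambda> (potential (\<lambda>t. \<alpha> * t\<^sup>2) J \<Lambda> \<omega>))
       \<and> (INF \<Lambda> \<in> {\<Lambda> :: (int ^ 'd) set. finite \<Lambda> \<and> \<Lambda> \<noteq> {}}. INF \<omega>.
            log_sobolev_const \<Lambda> (potential (\<lambda>t. \<alpha> * t\<^sup>2) J \<Lambda> \<omega>))
         \<ge> ereal (2 * \<alpha>)"
proof
  have gap: "log_sobolev_const \<Lambda> (potential (\<lambda>t. \<alpha> * t\<^sup>2) J \<Lambda> \<omega>)
      \<le> spectral_gap \<Lambda> (potential (\<lambda>t. \<alpha> * t\<^sup>2) J \<Lambda> \<omega>)"
    if "finite \<Lambda>" for \<Lambda> :: "(int ^ 'd) set" and \<omega>
  proof -
    interpret gibbs_potential \<Lambda> "potential (\<lambda>t. \<alpha> * t\<^sup>2) J \<Lambda> \<omega>"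
      using assms that by (rule gibbs_potential_quadratic)
    have "\<forall>f\<in>test_funs \<Lambda>. \<sigma> * variance f \<le> dirichlet \<Lambda> (potential (\<lambda>t. \<alpha> * t\<^sup>2) J \<Lambda> \<omega>) f"
      if "\<forall>f\<in>test_funs \<Lambda>. \<sigma> * Ent \<mu> (\<lambda>x. (f x)\<^sup>2) \<le> 2 * dirichlet \<Lambda> (potential (\<lambda>t. \<alpha> * t\<^sup>2) J \<Lambda> \<omega>) f"
      for \<sigma>
      using bspec[OF that] by (intro ballI log_sobolev_imp_poincare)
    then show ?thesis
      unfolding log_sobolev_const_def spectral_gap_def by (intro Sup_subset_mono Collect_mono) blast
  qed
  show "(INF \<Lambda> \<in> {\<Lambda> :: (int ^ 'd) set. finite \<Lambda> \<and> \<Lambda> \<noteq> {}}. INF \<omega>.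
            spectral_gap \<Lambda> (potential (\<lambda>t. \<alpha> * t\<^sup>2) J \<Lambda> \<omega>))
         \<ge> (INF \<Lambda> \<in> {\<Lambda> :: (int ^ 'd) set. finite \<Lambda> \<and> \<Lambda> \<noteq> {}}. INF \<omega>.
            log_sobolev_const \<Lambda> (potential (\<lambda>t. \<alpha> * t\<^sup>2) J \<Lambda> \<omega>))"
  proof (rule INF_superset_mono[OF subset_refl], rule INF_superset_mono[OF subset_refl])
    fix \<Lambda> :: "(int ^ 'd) set" and \<omega>
    assume "\<Lambda> \<in> {\<Lambda>. finite \<Lambda> \<and> \<Lambda> \<noteq> {}}"
    then show "log_sobolev_const \<Lambda> (potential (\<lambda>t. \<alpha> * t\<^sup>2) J \<Lambda> \<omega>)
        \<le> spectral_gap \<Lambda> (potential (\<lambda>t. \<alpha> * t\<^sup>2) J \<Lambda> \<omega>)"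
      by (simp add: gap)
  qed
  have "ereal (2 * \<alpha>) \<le> log_sobolev_const \<Lambda> (potential (\<lambda>t. \<alpha> * t\<^sup>2) J \<Lambda> \<omega>)"
    if "finite \<Lambda>" for \<Lambda> :: "(int ^ 'd) set" and \<omega>
  proof -
    interpret gibbs_potential \<Lambda> "potential (\<lambda>t. \<alpha> * t\<^sup>2) J \<Lambda> \<omega>"
      using assms that by (rule gibbs_potential_quadratic)
    have "2 * \<alpha> * Ent \<mu> (\<lambda>x. (f x)\<^sup>2) \<le> 2 * dirichlet \<Lambda> (potential (\<lambda>t. \<alpha> * t\<^sup>2) J \<Lambda> \<omega>) f"
      if "f \<in> test_funs \<Lambda>" for f
    proof -
      have "\<alpha> * Ent \<mu> (\<lambda>x. (f x)\<^sup>2) \<le> dirichlet \<Lambda> (potential (\<lambda>t. \<alpha> * t\<^sup>2) J \<Lambda> \<omega>) f"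
      proof (rule log_sobolev_uniformly_convex[OF assms(2) _ that])
        fix x y :: "int ^ 'd \<Rightarrow> real" and t s :: real
        assume "0 < t" "0 < s" "t + s = 1"
        then show "\<alpha> * t * s * (\<Sum>i\<in>\<Lambda>. (x i - y i)\<^sup>2)
            \<le> t * potential (\<lambda>v. \<alpha> * v\<^sup>2) J \<Lambda> \<omega> x + s * potential (\<lambda>v. \<alpha> * v\<^sup>2) J \<Lambda> \<omega> y
              - potential (\<lambda>v. \<alpha> * v\<^sup>2) J \<Lambda> \<omega> (\<lambda>i\<in>\<Lambda>. t * x i + s * y i)"
          by (rule potential_uniformly_convex[OF assms(1)])
      qed
      then show ?thesis by simp
    qed
    then show ?thesis
      unfolding log_sobolev_const_def by (intro Sup_upper CollectI exI[of _ "2 * \<alpha>"]) simp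
  qed
  then show "(INF \<Lambda> \<in> {\<Lambda> :: (int ^ 'd) set. finite \<Lambda> \<and> \<Lambda> \<noteq> {}}. INF \<omega>.
            log_sobolev_const \<Lambda> (potential (\<lambda>t. \<alpha> * t\<^sup>2) J \<Lambda> \<omega>))
         \<ge> ereal (2 * \<alpha>)"
    by (intro INF_greatest) simp
qed

end
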